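(* Let $\tau$ be a recurrent renewal (with $\mathbf P(\tau_1=n)=L(n)/n^{1+\alpha}$, $\alpha>0$, $L$ slowly varying). Let $\tau^{(1)}$ and $\tau^{(2)}$ be two independent copies of $\tau$, with joint law $\mathbf P^{\otimes2}$. If the renewal process $\tau':=\tau^{(1)}\cap\tau^{(2)}$ is transient, then $Z_\infty^{\beta,\omega}>0$ $\mathbb P$-a.s. for all $0\le\beta<\beta_2$, where $$\beta_2:=\inf\Big\{\beta\ge0\ :\ \lambda(2\beta)-2\lambda(\beta)>-\log\mathbf P^{\otimes2}(\tau_1'<\infty)\Big\}.$$
   Context: Renewal process. Under the law $\mathbf P$ (expectation $\mathbf E$), $\tau=(\tau_n)_{n\ge 0}$ is a renewal sequence: $\tau_0=0$ and the increments $\tau_{n+1}-\tau_n$ are i.i.d. with values in $\{1,2,\dots\}$ and law $\mathbf P(\tau_1=n)=L(n)/n^{1+\alpha}$, $n\ge1$, where $\alpha>0$ and $L:(0,\infty)\to(0,\infty)$ is slowly varying, i.e. measurable with $\lim_{x\to\infty}L(xu)/L(x)=1$ for all $u>0$. Recurrent means $\sum_{n\ge1}\mathbf P(\tau_1=n)=1$. $\tau$ is also viewed as the random subset $\{\tau_k:k\ge0\}$ of $\{0,1,2,\dots\}$. $\tau'_1$ denotes the smallest strictly positive element of $\tau'$ ($\tau_1'=\infty$ if there is none), and $\tau'$ is transient if $\mathbf P^{\otimes2}(\tau_1'<\infty)<1$. The convention $\inf\emptyset=+\infty$ is used. Environment. $\omega=(\omega_n)_{n\ge1}$ is a sequence of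 i.i.d. real random variables (law $\mathbb P$, expectation $\mathbb E$), independent of $\tau$, with mean $0$, variance $1$ and exponential moments: $\lambda(\beta):=\log\mathbb E[\exp(\beta\omega_1)]<\infty$ for all $\beta\ge 0$. Model. For $\beta\ge0$, $N\ge1$, let $$Z_N^{\beta,-\lambda(\beta),\omega}:=\mathbf E\Big[\exp\Big(\sum_{n=1}^N(\beta\omega_n-\lambda(\beta))\mathbf 1_{\{n\in\tau\}}\Big)\Big].$$ The sequence $\big(Z_N^{\beta,-\lambda(\beta),\omega}\big)_{N\ge1}$ is a non-negative martingale with respect to the filtration $\mathcal F_N:=\sigma(\omega_n,\,n\le N)$, and $Z_\infty^{\beta,\omega}:=\lim_{N\to\infty}Z_N^{\beta,-\lambda(\beta),\omega}$ denotes its $\mathbb P$-a.s. limit. *)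

theory Defs
  imports "HOL-Probability.Probability"
begin

text \<open>Only the restriction of \<open>L\<close> to the positive half-line matters.\<close>

definition slowly_varying :: "(real \<Rightarrow> real) \<Rightarrow> bool" where
  "slowly_varying L \<longleftrightarrow>
     (\<forall>x>0. L x > 0) \<and>
     L \<in> borel_measurable (restrict_space borel {0<..}) \<and>
     (\<forall>u>0. ((\<lambda>x. L (x * u) / L x) \<longlongrightarrow> 1) at_top)"

text \<open>
  The increments take values in the positive integers, so the truncated subtraction on
  \<^typ>\<open>nat\<close> below is a genuine subtraction.
\<close>

definition renewal_process ::
    "'a measure \<Rightarrow> (nat \<Rightarrow> 'a \<Rightarrow> nat) \<Rightarrow> real \<Rightarrow> (real \<Rightarrow> real) \<Rightarrow> bool" where
  "renewal_process M \<tau> \<alpha> L \<longleftrightarrow>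
     prob_space M \<and>
     0 < \<alpha> \<and> slowly_varying L \<and>
     (\<forall>x\<in>space M. \<tau> 0 x = 0) \<and>
     (\<forall>k. \<forall>x\<in>space M. \<tau> k x < \<tau> (Suc k) x) \<and>
     prob_space.indep_vars M (\<lambda>_. count_space UNIV) (\<lambda>k x. \<tau> (Suc k) x - \<tau> k x) UNIV \<and>
     (\<forall>k. \<forall>n\<ge>1. measure M {x \<in> space M. \<tau> (Suc k) x - \<tau> k x = n}
                   = L (real n) / real n powr (1 + \<alpha>))"

definition recurrent :: "'a measure \<Rightarrow> (nat \<Rightarrow> 'a \<Rightarrow> nat) \<Rightarrow> bool" where
  "recurrent M \<tau> \<longleftrightarrow> (\<lambda>n. measure M {x \<in> space M. \<tau> 1 x = Suc n}) sums 1"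

definition renewal_set :: "(nat \<Rightarrow> 'a \<Rightarrow> nat) \<Rightarrow> 'a \<Rightarrow> nat set" where
  "renewal_set \<tau> x = range (\<lambda>k. \<tau> k x)"

text \<open>The infimum is taken in \<^typ>\<open>enat\<close>, so it is \<open>\<infinity>\<close> if there is no positive element.\<close>

definition first_positive :: "nat set \<Rightarrow> enat" where
  "first_positive A = (INF n\<in>{n\<in>A. 0 < n}. enat n)"

text \<open>
  The two independent copies of \<open>\<tau>\<close> are \<open>\<tau> \<circ> fst\<close> and \<open>\<tau> \<circ> snd\<close> on the product of
  the underlying probability space with itself.
\<close>

definition intersection_set :: "(nat \<Rightarrow> 'a \<Rightarrow> nat) \<Rightarrow> 'a \<times> 'a \<Rightarrow> nat set" where
  "intersection_set \<tau> z = renewal_set \<tau> (fst z) \<inter> renewal_set \<tau> (snd z)"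

definition intersection_return_prob :: "'a measure \<Rightarrow> (nat \<Rightarrow> 'a \<Rightarrow> nat) \<Rightarrow> real" where
  "intersection_return_prob M \<tau> =
     measure (M \<Otimes>\<^sub>M M)
       {z \<in> space (M \<Otimes>\<^sub>M M). first_positive (intersection_set \<tau> z) < \<infinity>}"

definition intersection_transient :: "'a measure \<Rightarrow> (nat \<Rightarrow> 'a \<Rightarrow> nat) \<Rightarrow> bool" where
  "intersection_transient M \<tau> \<longleftrightarrow> intersection_return_prob M \<tau> < 1"

text \<open>The value \<open>\<omega> 0\<close> is irrelevant: the environment is indexed by the positive integers.\<close>

definition iid_environment :: "'b measure \<Rightarrow> (nat \<Rightarrow> 'b \<Rightarrow> real) \<Rightarrow> bool" where
  "iid_environment P \<omega> \<longleftrightarrow>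
     prob_space P \<and>
     prob_space.indep_vars P (\<lambda>_. borel) \<omega> {1..} \<and>
     (\<forall>n\<ge>1. distr P borel (\<omega> n) = distr P borel (\<omega> 1)) \<and>
     integrable P (\<omega> 1) \<and>
     prob_space.expectation P (\<omega> 1) = 0 \<and>
     integrable P (\<lambda>y. (\<omega> 1 y)\<^sup>2) \<and>
     prob_space.variance P (\<omega> 1) = 1 \<and>
     (\<forall>\<beta>\<ge>0. integrable P (\<lambda>y. exp (\<beta> * \<omega> 1 y)))"

definition log_mgf :: "'b measure \<Rightarrow> (nat \<Rightarrow> 'b \<Rightarrow> real) \<Rightarrow> real \<Rightarrow> real" where
  "log_mgf P \<omega> \<beta> = ln (prob_space.expectation P (\<lambda>y. exp (\<beta> * \<omega> 1 y)))"

text \<open>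
  The quenched partition function with pinning parameter \<open>h\<close>, as a function of a fixed
  realisation \<open>w\<close> of the environment. The expectation is over the renewal process only, which
  lives on its own probability space; this encodes the independence of \<open>\<tau>\<close> and \<open>\<omega>\<close>.
\<close>

definition partition_function ::
    "'a measure \<Rightarrow> (nat \<Rightarrow> 'a \<Rightarrow> nat) \<Rightarrow> real \<Rightarrow> real \<Rightarrow> (nat \<Rightarrow> real) \<Rightarrow> nat \<Rightarrow> real" where
  "partition_function M \<tau> \<beta> h w N =
     prob_space.expectation M
       (\<lambda>x. exp (\<Sum>n=1..N. (\<beta> * w n + h) * indicator (renewal_set \<tau> x) n))"

text \<open>
  The partition functions at \<open>h = - \<lambda>(\<beta>)\<close> form a nonnegative martingale, so the limit
  exists for almost every \<open>y\<close>. On the remaining null set \<^const>\<open>lim\<close> is unspecified.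
\<close>

definition limit_partition_function ::
    "'a measure \<Rightarrow> (nat \<Rightarrow> 'a \<Rightarrow> nat) \<Rightarrow> 'b measure \<Rightarrow> (nat \<Rightarrow> 'b \<Rightarrow> real) \<Rightarrow> real \<Rightarrow> 'b \<Rightarrow> real" where
  "limit_partition_function M \<tau> P \<omega> \<beta> y =
     lim (\<lambda>N. partition_function M \<tau> \<beta> (- log_mgf P \<omega> \<beta>) (\<lambda>n. \<omega> n y) N)"

text \<open>
  The infimum is taken in \<^typ>\<open>ereal\<close>, so it is \<open>\<infinity>\<close> for the empty set. The argument of the
  outer logarithm is positive, because both copies of \<open>\<tau>\<close> jump to \<open>1\<close> with positive
  probability \<open>(L 1)\<^sup>2\<close>.
\<close>

definition beta2 ::
    "'a measure \<Rightarrow> (nat \<Rightarrow> 'a \<Rightarrow> nat) \<Rightarrow> 'b measure \<Rightarrow> (nat \<Rightarrow> 'b \<Rightarrow> real) \<Rightarrow> ereal" where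
  "beta2 M \<tau> P \<omega> =
     Inf (ereal ` {\<beta>. 0 \<le> \<beta> \<and>
       log_mgf P \<omega> (2 * \<beta>) - 2 * log_mgf P \<omega> \<beta> > - ln (intersection_return_prob M \<tau>)})"

end

theory Submission
  imports Defs
begin

text \<open>
  The proof is a second-moment argument followed by a zero-one law. Since the two copies see the
  same environment, averaging \<open>Z\<^sub>N\<^sup>2\<close> over the environment leaves a factor
  \<open>r = exp (\<lambda>(2\<beta>) - 2\<lambda>(\<beta>))\<close> for each common renewal point in \<open>{1..N}\<close>. The common points
  themselves form a renewal set with return probability \<open>p < 1\<close>, so the expectation of
  \<open>r ^ (number of common points)\<close> is at most \<open>1 / (1 - r * p)\<close> as soon as \<open>r * p < 1\<close>. This bound,
  \<open>overlap_moment_le\<close>, comes from a decomposition at the first common point and rests on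
  \<open>pattern_prob_renewal\<close>: the renewal points before and after a deterministic renewal time are
  independent.

  The condition \<open>r * p < 1\<close> has to be derived for every \<open>\<beta>\<close> below \<open>\<beta>\<^sub>2\<close>. The definition of the infimum
  only gives \<open>r * p \<le> 1\<close>, but it does so at a slightly larger \<open>\<beta>\<close> as well; as
  \<open>\<lambda>(2\<beta>) - 2\<lambda>(\<beta>)\<close> is strictly increasing (\<open>mgf_ratio_strict_mono\<close>, where non-degeneracy of the
  environment enters), the inequality at \<open>\<beta>\<close> is strict.

  Once the martingale \<open>Z\<^sub>N\<close> is bounded in \<open>L\<^sup>2\<close>, it converges almost surely
  (\<open>square_integrable_martingale.AE_convergent\<close>), and it cannot tend to \<open>0\<close> almost surely, because
  its mean is \<open>1\<close> and it is uniformly integrable. Changing finitely many of the disorder variables multiplies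
  \<open>Z\<^sub>N\<close> by a factor between two positive bounds that do not depend on \<open>N\<close>, so \<open>Z\<^sub>N \<longlonglongrightarrow> 0\<close> is a tail event
  (\<open>vanishing_zero_one\<close>). Its probability is therefore \<open>0\<close>, and the limit is positive.

  Everything up to time \<open>N\<close> is a finite sum over the possible sets \<open>A \<subseteq> {1..N}\<close> of renewal points,
  weighted by \<open>pattern_prob N A\<close>. In this form the exchange of the two expectations and all
  measurability questions become trivial.
\<close>

section \<open>The renewal property at a deterministic time\<close>

text \<open>
  A set whose last point \<open>m\<close> is a renewal time determines the number \<open>card A\<close> of jumps needed to reach
  \<open>m\<close>. The random event on the left-hand side thereby becomes one about a fixed number of jumps.
\<close>

lemma strict_mono_image_initial_segment:
  fixes t :: "nat \<Rightarrow> nat"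
  assumes t: "strict_mono t" "t 0 = 0" and A: "A \<subseteq> {1..m}" "m \<in> A"
  shows "range t \<inter> {1..m} = A \<longleftrightarrow> t ` {1..card A} = A"
    and "range t \<inter> {1..m} = A \<Longrightarrow> t (card A) = m"
proof -
  have seg: "range t \<inter> {1..t j} = t ` {1..j}" for j
  proof (intro equalityI subsetI)
    fix y assume "y \<in> range t \<inter> {1..t j}"
    then obtain i where "y = t i" "1 \<le> t i" "t i \<le> t j" by auto
    moreover have "i \<noteq> 0" using \<open>1 \<le> t i\<close> t(2) by (cases i) auto
    ultimately show "y \<in> t ` {1..j}" using strict_mono_less_eq[OF t(1)] by auto
  next
    fix y assume "y \<in> t ` {1..j}"
    then obtain i where "y = t i" "1 \<le> i" "i \<le> j" by auto
    moreover have "t 0 < t i" using \<open>1 \<le> i\<close> strict_mono_less[OF t(1)] by simp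
    ultimately show "y \<in> range t \<inter> {1..t j}" using strict_mono_less_eq[OF t(1)] t(2) by auto
  qed
  have card_seg: "card (t ` {1..j}) = j" for j
    using card_image[of t "{1..j}"] strict_mono_imp_inj_on[OF t(1)] by (simp add: inj_on_subset)
  have fwd: "t (card A) = m" if "range t \<inter> {1..m} = A"
  proof -
    have "m \<in> range t" using that A(2) by blast
    then obtain j where j: "t j = m" by (elim rangeE) simp
    have "A = t ` {1..j}" using seg[of j] j that by simp
    then show ?thesis using card_seg j by metis
  qed
  then show "range t \<inter> {1..m} = A \<Longrightarrow> t (card A) = m" by blast
  show "range t \<inter> {1..m} = A \<longleftrightarrow> t ` {1..card A} = A"
  proof
    assume *: "range t \<inter> {1..m} = A"
    show "t ` {1..card A} = A" using seg[of "card A"] fwd[OF *] * by simp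
  next
    assume *: "t ` {1..card A} = A"
    obtain i where i: "t i = m" "i \<in> {1..card A}" using * A(2) by (metis imageE)
    have "t (card A) \<in> A" using * i(2) by (metis atLeastAtMost_iff image_eqI le_trans order_refl)
    then have "t (card A) \<le> m" using A(1) by auto
    moreover have "m \<le> t (card A)" using i strict_mono_less_eq[OF t(1)] by auto
    ultimately show "range t \<inter> {1..m} = A" using seg[of "card A"] * by simp
  qed
qed

text \<open>
  The two conditions on the right-hand side depend on the first \<open>card A\<close> gaps and on all later gaps,
  respectively, which is what makes them independent for a random \<open>t\<close>.
\<close>

lemma pattern_at_renewal_point:
  fixes t :: "nat \<Rightarrow> nat"
  assumes t: "strict_mono t" "t 0 = 0"
    and A: "A \<subseteq> {1..m}" "m \<in> A" and B: "B \<subseteq> {1..n}"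
  shows "range t \<inter> {1..m + n} = A \<union> (+) m ` B \<longleftrightarrow>
    t ` {1..card A} = A \<and> range (\<lambda>j. t (card A + j) - t (card A)) \<inter> {1..n} = B"
proof -
  define k where "k = card A"
  have later: "range (\<lambda>j. t (k + j) - t k) \<inter> {1..n} = (\<lambda>y. y - m) ` (range t \<inter> {m<..m + n})"
    if k: "t k = m"
  proof (intro equalityI subsetI)
    fix y assume "y \<in> range (\<lambda>j. t (k + j) - t k) \<inter> {1..n}"
    then obtain j where "y = t (k + j) - m" "1 \<le> y" "y \<le> n" using k by auto
    then show "y \<in> (\<lambda>y. y - m) ` (range t \<inter> {m<..m + n})" by (intro image_eqI[of _ _ "t (k + j)"]) auto
  next
    fix y assume "y \<in> (\<lambda>y. y - m) ` (range t \<inter> {m<..m + n})"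
    then obtain i where i: "y = t i - m" "m < t i" "t i \<le> m + n" by auto
    then have "k < i" using k strict_mono_less[OF t(1)] by auto
    then obtain j where "i = k + j" using less_imp_add_positive by blast
    then show "y \<in> range (\<lambda>j. t (k + j) - t k) \<inter> {1..n}" using i k by auto
  qed
  have B_eq: "(\<lambda>y. y - m) ` ((+) m ` B) = B" by (simp add: image_image)
  show ?thesis
  proof
    assume *: "range t \<inter> {1..m + n} = A \<union> (+) m ` B"
    have "range t \<inter> {1..m} = (range t \<inter> {1..m + n}) \<inter> {1..m}" by auto
    also have "\<dots> = A" unfolding * using A B by auto
    finally have 1: "range t \<inter> {1..m} = A" .
    have "range t \<inter> {m<..m + n} = (range t \<inter> {1..m + n}) \<inter> {m<..m+n}" by auto
    also have "\<dots> = (+) m ` B" unfolding * using A B by auto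
    finally have 2: "range t \<inter> {m<..m + n} = (+) m ` B" .
    have "t k = m" using strict_mono_image_initial_segment(2)[OF t A 1] by (simp add: k_def)
    from later[OF this] 2 B_eq 1 show "t ` {1..card A} = A \<and> range (\<lambda>j. t (card A + j) - t (card A)) \<inter> {1..n} = B"
      using strict_mono_image_initial_segment(1)[OF t A] by (simp add: k_def)
  next
    assume *: "t ` {1..card A} = A \<and> range (\<lambda>j. t (card A + j) - t (card A)) \<inter> {1..n} = B"
    then have 1: "range t \<inter> {1..m} = A" using strict_mono_image_initial_segment(1)[OF t A] by simp
    then have "t k = m" using strict_mono_image_initial_segment(2)[OF t A] by (simp add: k_def)
    from later[OF this] * have "(\<lambda>y. y - m) ` (range t \<inter> {m<..m + n}) = B" by (simp add: k_def)
    then have "(+) m ` B = (+) m ` ((\<lambda>y. y - m) ` (range t \<inter> {m<..m + n}))" by simp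
    also have "\<dots> = range t \<inter> {m<..m + n}" by (force simp: image_image intro: image_eqI)
    finally have "(+) m ` B = range t \<inter> {m<..m + n}" .
    moreover have "range t \<inter> {1..m + n} = (range t \<inter> {1..m}) \<union> (range t \<inter> {m<..m + n})" by auto
    ultimately show "range t \<inter> {1..m + n} = A \<union> (+) m ` B" using 1 by simp
  qed
qed

locale iid_renewal = prob_space M for M :: "'a measure" +
  fixes \<tau> :: "nat \<Rightarrow> 'a \<Rightarrow> nat"
  assumes start: "x \<in> space M \<Longrightarrow> \<tau> 0 x = 0"
    and increasing: "x \<in> space M \<Longrightarrow> \<tau> k x < \<tau> (Suc k) x"
    and gaps_indep: "indep_vars (\<lambda>_. count_space UNIV) (\<lambda>k x. \<tau> (Suc k) x - \<tau> k x) UNIV"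
    and gaps_identical: "n \<ge> 1 \<Longrightarrow> prob {x \<in> space M. \<tau> (Suc k) x - \<tau> k x = n}
      = prob {x \<in> space M. \<tau> (Suc 0) x - \<tau> 0 x = n}"
begin

definition gap :: "nat \<Rightarrow> 'a \<Rightarrow> nat" where
  "gap k x = \<tau> (Suc k) x - \<tau> k x"

definition pattern_prob :: "nat \<Rightarrow> nat set \<Rightarrow> real" where
  "pattern_prob N A = prob {x \<in> space M. renewal_set \<tau> x \<inter> {1..N} = A}"

lemma measurable_gap [measurable]: "gap k \<in> measurable M (count_space UNIV)"
  using gaps_indep unfolding indep_vars_def gap_def[abs_def] by auto

lemma strict_mono_tau: "x \<in> space M \<Longrightarrow> strict_mono (\<lambda>k. \<tau> k x)"
  by (intro strict_mono_Suc_iff[THEN iffD2] allI increasing)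

lemma tau_add: "x \<in> space M \<Longrightarrow> \<tau> (k + j) x = \<tau> k x + (\<Sum>i<j. gap (k + i) x)"
proof (induction j)
  case (Suc j)
  then show ?case using increasing[of x "k + j"] by (simp add: gap_def)
qed simp

lemma tau_eq_sum: "x \<in> space M \<Longrightarrow> \<tau> j x = (\<Sum>i<j. gap i x)"
  using tau_add[of x 0 j] start by simp

lemma measurable_tau [measurable]: "\<tau> j \<in> measurable M (count_space UNIV)"
proof -
  have "(\<lambda>x. \<Sum>i<j. gap i x) \<in> measurable M (count_space UNIV)" by measurable
  then show ?thesis by (rule measurable_cong[THEN iffD1, rotated]) (simp add: tau_eq_sum)
qed

lemma pred_pattern [measurable]: "Measurable.pred M (\<lambda>x. renewal_set \<tau> x \<inter> {1..N} = A)"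
proof -
  have "(renewal_set \<tau> x \<inter> {1..N} = A) \<longleftrightarrow> (\<forall>n. ((\<exists>k. \<tau> k x = n) \<and> n \<in> {1..N}) = (n \<in> A))" for x
    unfolding renewal_set_def by (auto simp: set_eq_iff image_iff; metis)
  then show ?thesis by simp
qed

lemma gap_distr: "distr M (count_space UNIV) (gap k) = distr M (count_space UNIV) (gap 0)"
proof (rule measure_eqI_countable[of _ UNIV])
  fix n :: nat
  have "prob (gap k -` {n} \<inter> space M) = prob (gap 0 -` {n} \<inter> space M)"
  proof (cases "n \<ge> 1")
    case True
    have eq: "gap k -` {n} \<inter> space M = {x \<in> space M. \<tau> (Suc k) x - \<tau> k x = n}" for k
      by (auto simp: gap_def)
    show ?thesis unfolding eq by (rule gaps_identical[OF True])
  next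
    case False
    have "gap k x \<ge> 1" if "x \<in> space M" for x k
      using increasing[OF that, of k] by (simp add: gap_def)
    with False have "gap k -` {n} \<inter> space M = {}" for k
      by force
    then show ?thesis by simp
  qed
  then show "emeasure (distr M (count_space UNIV) (gap k)) {n} = emeasure (distr M (count_space UNIV) (gap 0)) {n}"
    by (simp add: emeasure_distr emeasure_eq_measure)
qed auto

lemma shifted_gaps_distr:
  "distr M (\<Pi>\<^sub>M i\<in>UNIV. count_space UNIV) (\<lambda>x i. gap (k + i) x) =
   distr M (\<Pi>\<^sub>M i\<in>UNIV. count_space UNIV) (\<lambda>x i. gap i x)"
proof -
  let ?C = "\<lambda>i::nat. count_space UNIV :: nat measure"
  let ?K = "distr M (count_space UNIV) (gap 0)"
  have *: "distr M (Pi\<^sub>M UNIV ?C) (\<lambda>x i. gap i x) = (\<Pi>\<^sub>M i\<in>UNIV. ?K)"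
  proof -
    have "indep_vars ?C gap UNIV" using gaps_indep by (simp add: gap_def[abs_def])
    then have "distr M (Pi\<^sub>M UNIV ?C) (\<lambda>x. \<lambda>i\<in>UNIV. gap i x) = (\<Pi>\<^sub>M i\<in>UNIV. distr M (count_space UNIV) (gap i))"
      by (subst (asm) indep_vars_iff_distr_eq_PiM) auto
    also have "\<dots> = (\<Pi>\<^sub>M i\<in>UNIV. ?K)" by (rule arg_cong[where f="Pi\<^sub>M UNIV"], rule ext, rule gap_distr)
    finally show ?thesis by (simp add: restrict_def)
  qed
  have "distr M (Pi\<^sub>M UNIV ?C) (\<lambda>x i. gap (k + i) x)
      = distr (distr M (Pi\<^sub>M UNIV ?C) (\<lambda>x i. gap i x)) (Pi\<^sub>M UNIV ?C) (\<lambda>g i. g (k + i))"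
    by (subst distr_distr) (auto simp: comp_def intro!: measurable_PiM_single')
  also have "\<dots> = distr (\<Pi>\<^sub>M i\<in>UNIV. ?K) (\<Pi>\<^sub>M i\<in>UNIV. ?K) (\<lambda>g. \<lambda>i\<in>UNIV. g (k + i))"
    unfolding * by (intro distr_cong) (auto intro!: sets_PiM_cong)
  also have "\<dots> = (\<Pi>\<^sub>M i\<in>UNIV. ?K)"
    by (rule distr_PiM_reindex) (auto intro!: prob_space_distr)
  finally show ?thesis using * by simp
qed

text \<open>
  The process restarted at its \<open>k\<close>-th renewal is a function of the gaps from \<open>k\<close> on, and these have the
  same joint law as all gaps.
\<close>

lemma shifted_pattern_prob:
  "prob {x \<in> space M. range (\<lambda>j. \<tau> (k + j) x - \<tau> k x) \<inter> {1..n} = B} = pattern_prob n B"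
proof -
  let ?C = "\<lambda>i::nat. count_space UNIV :: nat measure"
  let ?Q = "\<lambda>g. \<forall>a. ((\<exists>j. (\<Sum>i<j. g i) = a) \<and> a \<in> {1..n}) = (a \<in> B)"
  have Q: "range (\<lambda>j. \<Sum>i<j. g i) \<inter> {1..n} = B \<longleftrightarrow> ?Q g" for g :: "nat \<Rightarrow> nat"
    by (auto simp: set_eq_iff image_iff; metis)
  have [measurable]: "(\<lambda>g. g i) \<in> measurable (Pi\<^sub>M UNIV ?C) (count_space UNIV)" for i
    by (rule measurable_component_singleton) simp
  have [measurable]: "(\<lambda>g. \<Sum>i<j. g i) \<in> measurable (Pi\<^sub>M UNIV ?C) (count_space UNIV)" for j by measurable
  have meas: "{g \<in> space (Pi\<^sub>M UNIV ?C). ?Q g} \<in> sets (Pi\<^sub>M UNIV ?C)" by measurable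
  have shift: "prob {x \<in> space M. range (\<lambda>j. \<tau> (k + j) x - \<tau> k x) \<inter> {1..n} = B}
    = measure (distr M (Pi\<^sub>M UNIV ?C) (\<lambda>x i. gap (k + i) x)) {g \<in> space (Pi\<^sub>M UNIV ?C). ?Q g}" for k
  proof -
    have "{x \<in> space M. range (\<lambda>j. \<tau> (k + j) x - \<tau> k x) \<inter> {1..n} = B}
      = (\<lambda>x i. gap (k + i) x) -` {g \<in> space (Pi\<^sub>M UNIV ?C). ?Q g} \<inter> space M"
      unfolding Q[symmetric] by (auto simp: tau_add space_PiM)
    then show ?thesis
      by (subst measure_distr[OF _ meas]) (auto intro!: measurable_PiM_single')
  qed
  have "pattern_prob n B = prob {x \<in> space M. range (\<lambda>j. \<tau> (0 + j) x - \<tau> 0 x) \<inter> {1..n} = B}"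
    unfolding pattern_prob_def renewal_set_def
    by (intro arg_cong[where f=prob] Collect_cong conj_cong) (auto simp: start)
  then show ?thesis using shift[of k] shift[of 0] shifted_gaps_distr[of k] by simp
qed

text \<open>
  This is the renewal property at the deterministic time \<open>m\<close>. The pattern up to \<open>m\<close> is an event of the first
  \<open>card A\<close> gaps and the later pattern one of the remaining gaps; as \<open>card A\<close> is a constant, these two blocks
  are independent.
\<close>

lemma pattern_prob_renewal:
  assumes A: "A \<subseteq> {1..m}" "m \<in> A" and B: "B \<subseteq> {1..n}"
  shows "pattern_prob (m + n) (A \<union> (+) m ` B) = pattern_prob m A * pattern_prob n B"
proof -
  let ?C = "\<lambda>i::nat. count_space UNIV :: nat measure"
  define k where "k = card A"
  let ?past = "\<lambda>x. \<lambda>i\<in>{..<k}. gap i x" and ?future = "\<lambda>x. \<lambda>i\<in>{k..}. gap i x"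
  have ind: "indep_var (Pi\<^sub>M {..<k} ?C) ?past (Pi\<^sub>M {k..} ?C) ?future"
    using gaps_indep unfolding gap_def[abs_def, symmetric] by (rule indep_var_restrict) auto
  \<comment> \<open>The primed versions spell out the set equations pointwise, so that their measurability is evident.\<close>
  let ?P = "\<lambda>g. (\<lambda>j. \<Sum>i<j. g i) ` {1..k} = A"
  let ?P' = "\<lambda>g. \<forall>a. (\<exists>j\<in>{1..k}. (\<Sum>i<j. g i) = a) = (a \<in> A)"
  let ?F = "\<lambda>g. range (\<lambda>j. \<Sum>i<j. g (k + i)) \<inter> {1..n} = B"
  let ?F' = "\<lambda>g. \<forall>a. ((\<exists>j. (\<Sum>i<j. g (k + i)) = a) \<and> a \<in> {1..n}) = (a \<in> B)"
  have P: "?P g \<longleftrightarrow> ?P' g" for g :: "nat \<Rightarrow> nat"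
    by (auto simp: set_eq_iff image_iff; metis)
  have F: "?F g \<longleftrightarrow> ?F' g" for g :: "nat \<Rightarrow> nat"
    by (auto simp: set_eq_iff image_iff; metis)
  define XP where "XP = {g \<in> space (Pi\<^sub>M {..<k} ?C). ?P' g}"
  define XF where "XF = {g \<in> space (Pi\<^sub>M {k..} ?C). ?F' g}"
  have [measurable]: "(\<lambda>g. \<Sum>i<j. g i) \<in> measurable (Pi\<^sub>M {..<k} ?C) (count_space UNIV)" if "j \<in> {1..k}" for j
    using that by (intro measurable_sum_nat measurable_component_singleton) auto
  have [measurable]: "(\<lambda>g. g (k + i)) \<in> measurable (Pi\<^sub>M {k..} ?C) (count_space UNIV)" for i
    by (rule measurable_component_singleton) simp
  have [measurable]: "(\<lambda>g. \<Sum>i<j. g (k + i)) \<in> measurable (Pi\<^sub>M {k..} ?C) (count_space UNIV)" for j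
    by measurable
  have XP: "XP \<in> sets (Pi\<^sub>M {..<k} ?C)" unfolding XP_def by measurable
  have XF: "XF \<in> sets (Pi\<^sub>M {k..} ?C)" unfolding XF_def by measurable
  have past: "?past -` XP \<inter> space M = {x \<in> space M. (\<lambda>j. \<tau> j x) ` {1..k} = A}"
  proof -
    have "(\<lambda>j. \<Sum>i<j. ?past x i) ` {1..k} = (\<lambda>j. \<tau> j x) ` {1..k}" if "x \<in> space M" for x
      using that by (intro image_cong) (auto simp: tau_eq_sum)
    then show ?thesis unfolding XP_def P[symmetric] by (auto simp: space_PiM)
  qed
  have future: "?future -` XF \<inter> space M = {x \<in> space M. range (\<lambda>j. \<tau> (k + j) x - \<tau> k x) \<inter> {1..n} = B}"
    unfolding XF_def F[symmetric] by (auto simp: space_PiM tau_add)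
  have "{x \<in> space M. renewal_set \<tau> x \<inter> {1..m + n} = A \<union> (+) m ` B}
      = (\<lambda>x. (?past x, ?future x)) -` (XP \<times> XF) \<inter> space M" (is "?L = ?R")
  proof -
    have "?R = (?past -` XP \<inter> space M) \<inter> (?future -` XF \<inter> space M)" by auto
    also have "\<dots> = {x \<in> space M. (\<lambda>j. \<tau> j x) ` {1..k} = A
        \<and> range (\<lambda>j. \<tau> (k + j) x - \<tau> k x) \<inter> {1..n} = B}"
      unfolding past future by auto
    also have "\<dots> = ?L"
      unfolding renewal_set_def k_def
      by (intro Collect_cong conj_cong refl pattern_at_renewal_point[symmetric] strict_mono_tau start A B)
    finally show ?thesis by simp
  qed
  then have "pattern_prob (m + n) (A \<union> (+) m ` B)
      = prob (?past -` XP \<inter> space M) * prob (?future -` XF \<inter> space M)"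
    unfolding pattern_prob_def using indep_varD[OF ind XP XF] by simp
  also have "prob (?past -` XP \<inter> space M) = pattern_prob m A"
    unfolding past unfolding pattern_prob_def renewal_set_def k_def
    by (intro arg_cong[where f=prob] Collect_cong conj_cong refl
          strict_mono_image_initial_segment(1)[symmetric] strict_mono_tau start A)
  also have "prob (?future -` XF \<inter> space M) = pattern_prob n B"
    unfolding future by (rule shifted_pattern_prob)
  finally show ?thesis .
qed

end

section \<open>Common points of two independent copies\<close>

lemma first_positive_finite_iff: "first_positive A < \<infinity> \<longleftrightarrow> (\<exists>n\<in>A. 0 < n)"
  unfolding first_positive_def INF_less_iff by auto

context iid_renewal
begin

lemma sum_times_sum:
  fixes f g :: "'i \<Rightarrow> 'j \<Rightarrow> real"
  shows "(\<Sum>A\<in>X. \<Sum>B\<in>Y. \<Sum>A'\<in>U. \<Sum>B'\<in>V. f A B * g A' B')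
    = (\<Sum>A\<in>X. \<Sum>B\<in>Y. f A B) * (\<Sum>A\<in>U. \<Sum>B\<in>V. g A B)"
  by (simp add: sum_distrib_left[symmetric] sum_distrib_right[symmetric])

lemma pattern_prob_nonneg [simp]: "0 \<le> pattern_prob N A"
  by (simp add: pattern_prob_def)

lemma integral_pattern:
  fixes F :: "nat set \<Rightarrow> real"
  shows "(\<integral>x. F (renewal_set \<tau> x \<inter> {1..N}) \<partial>M) = (\<Sum>A\<in>Pow {1..N}. pattern_prob N A * F A)"
proof -
  let ?E = "\<lambda>A. {x \<in> space M. renewal_set \<tau> x \<inter> {1..N} = A}"
  have E: "?E A \<in> sets M" for A by measurable
  have "(\<integral>x. F (renewal_set \<tau> x \<inter> {1..N}) \<partial>M) = (\<integral>x. (\<Sum>A\<in>Pow {1..N}. indicator (?E A) x * F A) \<partial>M)"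
  proof (rule Bochner_Integration.integral_cong[OF refl])
    fix x assume x: "x \<in> space M"
    have "(\<Sum>A\<in>Pow {1..N}. indicator (?E A) x * F A)
        = (\<Sum>A\<in>{renewal_set \<tau> x \<inter> {1..N}}. indicator (?E A) x * F A)"
      by (rule sum.mono_neutral_right) (auto simp: indicator_def)
    then show "F (renewal_set \<tau> x \<inter> {1..N}) = (\<Sum>A\<in>Pow {1..N}. indicator (?E A) x * F A)"
      using x by simp
  qed
  also have "\<dots> = (\<Sum>A\<in>Pow {1..N}. \<integral>x. indicator (?E A) x * F A \<partial>M)"
    by (rule Bochner_Integration.integral_sum)
      (intro integrable_mult_left integrable_real_indicator E, simp add: emeasure_eq_measure)
  also have "\<dots> = (\<Sum>A\<in>Pow {1..N}. pattern_prob N A * F A)"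
  proof -
    have "?E A \<inter> space M = ?E A" for A by auto
    then show ?thesis by (simp add: pattern_prob_def)
  qed
  finally show ?thesis .
qed

lemma sum_pattern_prob: "(\<Sum>A\<in>Pow {1..N}. pattern_prob N A) = 1"
  using integral_pattern[of "\<lambda>_. 1" N] prob_space by simp

text \<open>
  Summation over the sets through \<open>m\<close> factorises along the bijection
  \<open>(A, B) \<mapsto> A \<union> (m + B)\<close> that glues a past to a future.
\<close>

lemma sum_pattern_prob_renewal:
  assumes m: "1 \<le> m"
  shows "(\<Sum>A\<in>{A\<in>Pow {1..m + n}. m \<in> A}. pattern_prob (m + n) A * F A)
    = (\<Sum>A\<in>{A\<in>Pow {1..m}. m \<in> A}. \<Sum>B\<in>Pow {1..n}.
        pattern_prob m A * pattern_prob n B * F (A \<union> (+) m ` B))"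
proof -
  have split: "(A \<inter> {1..m}) \<union> (+) m ` {b \<in> {1..n}. m + b \<in> A} = A" if "A \<subseteq> {1..m + n}" for A
  proof (intro equalityI subsetI)
    fix a assume a: "a \<in> A"
    show "a \<in> (A \<inter> {1..m}) \<union> (+) m ` {b \<in> {1..n}. m + b \<in> A}"
    proof (cases "a \<le> m")
      case False
      then show ?thesis using a that by (intro UnI2 image_eqI[where x="a - m"]) auto
    qed (use a that in auto)
  qed auto
  have "(\<Sum>A\<in>{A\<in>Pow {1..m}. m \<in> A}. \<Sum>B\<in>Pow {1..n}.
        pattern_prob m A * pattern_prob n B * F (A \<union> (+) m ` B))
      = (\<Sum>(A, B)\<in>{A\<in>Pow {1..m}. m \<in> A} \<times> Pow {1..n}.
        pattern_prob m A * pattern_prob n B * F (A \<union> (+) m ` B))"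
    by (rule sum.cartesian_product)
  also have "\<dots> = (\<Sum>A\<in>{A\<in>Pow {1..m + n}. m \<in> A}. pattern_prob (m + n) A * F A)"
  proof (rule sum.reindex_bij_witness[where i="\<lambda>A. (A \<inter> {1..m}, {b \<in> {1..n}. m + b \<in> A})"
        and j="\<lambda>(A, B). A \<union> (+) m ` B"], goal_cases)
    case (1 a) then show ?case by auto
  next
    case (2 a) then show ?case using m by auto
  next
    case (3 a) then show ?case using split[of a] by auto
  next
    case (4 a) then show ?case using m by auto
  next
    case (5 a)
    then show ?case by (auto simp: pattern_prob_renewal)
  qed
  finally show ?thesis by simp
qed

text \<open>
  This is the expectation of \<open>r\<close> to the number of common points in \<open>{1..N}\<close> of two independent
  copies.
\<close>

definition overlap_moment :: "real \<Rightarrow> nat \<Rightarrow> real" where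
  "overlap_moment r N =
     (\<Sum>A\<in>Pow {1..N}. \<Sum>B\<in>Pow {1..N}. pattern_prob N A * pattern_prob N B * r ^ card (A \<inter> B))"

definition first_meeting_prob :: "nat \<Rightarrow> real" where
  "first_meeting_prob m =
     (\<Sum>A\<in>{A\<in>Pow {1..m}. m \<in> A}. \<Sum>B\<in>{B\<in>Pow {1..m}. m \<in> B}.
        pattern_prob m A * pattern_prob m B * of_bool (A \<inter> B = {m}))"

lemma first_meeting_prob_nonneg: "0 \<le> first_meeting_prob m"
  unfolding first_meeting_prob_def by (intro sum_nonneg mult_nonneg_nonneg) auto

text \<open>
  The events that the first common point is \<open>m\<close> and that the two copies follow given patterns up to
  \<open>m\<close> are disjoint rectangles in the product space, and on each of them the copies meet.
\<close>

lemma sum_first_meeting_prob_le: "(\<Sum>m=1..N. first_meeting_prob m) \<le> intersection_return_prob M \<tau>"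
proof -
  interpret MM: pair_prob_space M M ..
  let ?E = "\<lambda>m A. {x \<in> space M. renewal_set \<tau> x \<inter> {1..m} = A}"
  define J where "J = (SIGMA m:{1..N}. {(A, B). A \<in> Pow {1..m} \<and> B \<in> Pow {1..m} \<and> A \<inter> B = {m}})"
  define H where "H = (\<lambda>(m, A, B). ?E m A \<times> ?E m B)"
  have E: "?E m A \<in> sets M" for m A by measurable
  have fin_pairs: "finite {(A, B). A \<in> Pow {1..m} \<and> B \<in> Pow {1..m} \<and> A \<inter> B = {m}}" for m :: nat
    by (rule finite_subset[of _ "Pow {1..m} \<times> Pow {1..m}"]) auto
  have fin: "finite J" unfolding J_def by (intro finite_SigmaI fin_pairs) auto
  have meas: "H ` J \<subseteq> sets (M \<Otimes>\<^sub>M M)"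
    unfolding H_def using pair_measureI[OF E E] by (simp add: image_subset_iff split_beta)
  \<comment> \<open>The first common point can be read off from the outcome, which separates rectangles with different \<open>m\<close>.\<close>
  have meeting: "Inf {i. 0 < i \<and> i \<in> intersection_set \<tau> z} = m"
    if "(m, A, B) \<in> J" "z \<in> H (m, A, B)" for m A B z
  proof -
    have *: "intersection_set \<tau> z \<inter> {1..m} = {m}"
      using that by (auto simp: J_def H_def intersection_set_def)
    show ?thesis unfolding Inf_nat_def
    proof (rule Least_equality)
      show "m \<in> {i. 0 < i \<and> i \<in> intersection_set \<tau> z}" using * by auto
    next
      fix y assume y: "y \<in> {i. 0 < i \<and> i \<in> intersection_set \<tau> z}"
      show "m \<le> y"
      proof (rule ccontr)
        assume "\<not> m \<le> y"
        then have "y \<in> intersection_set \<tau> z \<inter> {1..m}" using y by auto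
        then show False using * \<open>\<not> m \<le> y\<close> by auto
      qed
    qed
  qed
  have disj: "disjoint_family_on H J"
    unfolding disjoint_family_on_def
  proof (intro ballI impI, rule ccontr)
    fix a b assume ab: "a \<in> J" "b \<in> J" "a \<noteq> b" "H a \<inter> H b \<noteq> {}"
    obtain m A B m' A' B' where e: "a = (m, A, B)" "b = (m', A', B')" by (cases a, cases b) auto
    obtain z where z: "z \<in> H a" "z \<in> H b" using ab by auto
    have "m = m'" using meeting[of m A B z] meeting[of m' A' B' z] ab z e by simp
    then show False using z e ab(3) by (auto simp: H_def)
  qed
  have H: "measure (M \<Otimes>\<^sub>M M) (H (m, A, B)) = pattern_prob m A * pattern_prob m B" for m A B
    unfolding H_def pattern_prob_def measure_def
    by (simp only: prod.case emeasure_pair_measure_Times[OF E E] enn2real_mult)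
  have "(\<Sum>m=1..N. first_meeting_prob m)
      = (\<Sum>m=1..N. \<Sum>(A, B)\<in>{(A, B). A \<in> Pow {1..m} \<and> B \<in> Pow {1..m} \<and> A \<inter> B = {m}}.
           pattern_prob m A * pattern_prob m B)"
  proof (rule sum.cong[OF refl])
    fix m
    show "first_meeting_prob m = (\<Sum>(A, B)\<in>{(A, B). A \<in> Pow {1..m} \<and> B \<in> Pow {1..m} \<and> A \<inter> B = {m}}.
           pattern_prob m A * pattern_prob m B)"
      unfolding first_meeting_prob_def sum.cartesian_product
      by (rule sum.mono_neutral_cong_right) auto
  qed
  also have "\<dots> = (\<Sum>a\<in>J. measure (M \<Otimes>\<^sub>M M) (H a))"
    unfolding J_def by (subst sum.Sigma) (use fin_pairs in \<open>auto intro!: sum.cong simp: H\<close>)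
  also have "\<dots> = measure (M \<Otimes>\<^sub>M M) (\<Union>a\<in>J. H a)"
    by (rule MM.finite_measure_finite_Union[symmetric, OF fin meas disj])
  also have "\<dots> \<le> intersection_return_prob M \<tau>"
    unfolding intersection_return_prob_def
  proof (rule MM.finite_measure_mono)
    have ret: "first_positive (intersection_set \<tau> z) < \<infinity> \<longleftrightarrow>
        (\<exists>n>0. (\<exists>k. \<tau> k (fst z) = n) \<and> (\<exists>k. \<tau> k (snd z) = n))" for z
    proof -
      have "n \<in> intersection_set \<tau> z \<longleftrightarrow> (\<exists>k. \<tau> k (fst z) = n) \<and> (\<exists>k. \<tau> k (snd z) = n)" for n
        unfolding intersection_set_def renewal_set_def Int_iff image_iff by (metis UNIV_I)
      then show ?thesis unfolding first_positive_finite_iff by auto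
    qed
    show "{z \<in> space (M \<Otimes>\<^sub>M M). first_positive (intersection_set \<tau> z) < \<infinity>} \<in> sets (M \<Otimes>\<^sub>M M)"
      unfolding ret by measurable
    show "(\<Union>a\<in>J. H a) \<subseteq> {z \<in> space (M \<Otimes>\<^sub>M M). first_positive (intersection_set \<tau> z) < \<infinity>}"
    proof
      fix z assume "z \<in> (\<Union>a\<in>J. H a)"
      then obtain m A B where *: "(m, A, B) \<in> J" "z \<in> H (m, A, B)" by auto
      then have "m \<in> intersection_set \<tau> z" "0 < m" "z \<in> space (M \<Otimes>\<^sub>M M)"
        by (auto simp: J_def H_def intersection_set_def space_pair_measure)
      then show "z \<in> {z \<in> space (M \<Otimes>\<^sub>M M). first_positive (intersection_set \<tau> z) < \<infinity>}"
        unfolding first_positive_finite_iff by blast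
    qed
  qed
  finally show ?thesis .
qed

text \<open>
  Either the copies do not meet up to time \<open>N\<close>, or they first meet at some \<open>m\<close>. In the second case they
  collect one factor \<open>r\<close> at \<open>m\<close> and start afresh, with time \<open>N - m\<close> left.
\<close>

lemma overlap_moment_first_meeting:
  "overlap_moment r N = (\<Sum>A\<in>Pow {1..N}. \<Sum>B\<in>Pow {1..N}. pattern_prob N A * pattern_prob N B * of_bool (A \<inter> B = {}))
     + (\<Sum>m=1..N. r * first_meeting_prob m * overlap_moment r (N - m))"
proof -
  let ?q = "pattern_prob"
  have decomp: "r ^ card (A \<inter> B) = of_bool (A \<inter> B = {})
      + (\<Sum>m=1..N. of_bool (A \<inter> B \<inter> {1..m} = {m}) * r ^ card (A \<inter> B))"
    if AB: "A \<in> Pow {1..N}" "B \<in> Pow {1..N}" for A B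
  proof (cases "A \<inter> B = {}")
    case False
    define a where "a = Min (A \<inter> B)"
    have fin: "finite (A \<inter> B)" using AB by (auto intro: finite_subset)
    have a: "a \<in> A \<inter> B" "\<And>b. b \<in> A \<inter> B \<Longrightarrow> a \<le> b" using Min_in[OF fin False] Min_le[OF fin] by (simp_all only: a_def)
    have *: "A \<inter> B \<inter> {1..m} = {m} \<longleftrightarrow> m = a" if m: "m \<in> {1..N}" for m
    proof
      assume mm: "A \<inter> B \<inter> {1..m} = {m}"
      then have "m \<in> A \<inter> B" by blast
      then have "a \<le> m" by (rule a(2))
      then have "a \<in> A \<inter> B \<inter> {1..m}" using a(1) AB by auto
      then have "a \<in> {m}" unfolding mm .
      then show "m = a" by simp
    next
      assume [simp]: "m = a"
      show "A \<inter> B \<inter> {1..m} = {m}" using a m by (auto intro: antisym)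
    qed
    have "(\<Sum>m=1..N. of_bool (A \<inter> B \<inter> {1..m} = {m}) * r ^ card (A \<inter> B))
        = (\<Sum>m=1..N. if m = a then r ^ card (A \<inter> B) else 0)"
      by (intro sum.cong refl, simp only: * of_bool_def) simp
    also have "\<dots> = r ^ card (A \<inter> B)" using a(1) AB by auto
    finally show ?thesis using False by simp
  qed simp
  have term_eq: "(\<Sum>A\<in>Pow {1..N}. \<Sum>B\<in>Pow {1..N}. ?q N A * ?q N B * (of_bool (A \<inter> B \<inter> {1..m} = {m}) * r ^ card (A \<inter> B)))
      = r * first_meeting_prob m * overlap_moment r (N - m)" if m: "m \<in> {1..N}" for m
  proof -
    define n where "n = N - m"
    have N: "N = m + n" and m1: "1 \<le> m" using m by (auto simp: n_def)
    let ?F = "\<lambda>A B. of_bool (A \<inter> B \<inter> {1..m} = {m}) * r ^ card (A \<inter> B)"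
    let ?P = "{A \<in> Pow {1..m}. m \<in> A}" and ?PN = "{A \<in> Pow {1..N}. m \<in> A}"
    have F: "?F (A \<union> (+) m ` A') (B \<union> (+) m ` B') = of_bool (A \<inter> B = {m}) * (r * r ^ card (A' \<inter> B'))"
      if "A \<in> ?P" "B \<in> ?P" "A' \<in> Pow {1..n}" "B' \<in> Pow {1..n}" for A B A' B'
    proof -
      have 1: "(A \<union> (+) m ` A') \<inter> (B \<union> (+) m ` B') = (A \<inter> B) \<union> (+) m ` (A' \<inter> B')"
        using that by auto
      have 2: "(A \<union> (+) m ` A') \<inter> (B \<union> (+) m ` B') \<inter> {1..m} = A \<inter> B"
        using that by auto
      have 3: "card ({m} \<union> (+) m ` (A' \<inter> B')) = Suc (card (A' \<inter> B'))"
      proof -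
        have "finite (A' \<inter> B')" using that by (auto intro: finite_subset)
        moreover have "m \<notin> (+) m ` (A' \<inter> B')" using that by auto
        ultimately show ?thesis by (simp add: card_image)
      qed
      show ?thesis unfolding 2 using 3 by (auto simp: 1)
    qed
    have "(\<Sum>A\<in>Pow {1..N}. \<Sum>B\<in>Pow {1..N}. ?q N A * ?q N B * ?F A B)
        = (\<Sum>A\<in>?PN. \<Sum>B\<in>Pow {1..N}. ?q N A * ?q N B * ?F A B)"
      by (intro sum.mono_neutral_right ballI sum.neutral) auto
    also have "\<dots> = (\<Sum>A\<in>?PN. \<Sum>B\<in>?PN. ?q N A * ?q N B * ?F A B)"
      by (intro sum.cong refl sum.mono_neutral_right ballI) auto
    also have "\<dots> = (\<Sum>A\<in>?PN. ?q N A * (\<Sum>B\<in>?PN. ?q N B * ?F A B))"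
      by (simp add: sum_distrib_left mult.assoc)
    also have "\<dots> = (\<Sum>A\<in>?PN. ?q N A * (\<Sum>B\<in>?P. \<Sum>B'\<in>Pow {1..n}. ?q m B * ?q n B' * ?F A (B \<union> (+) m ` B')))"
      unfolding N by (subst sum_pattern_prob_renewal[OF m1]) simp
    also have "\<dots> = (\<Sum>A\<in>?P. \<Sum>A'\<in>Pow {1..n}. ?q m A * ?q n A' *
        (\<Sum>B\<in>?P. \<Sum>B'\<in>Pow {1..n}. ?q m B * ?q n B' * ?F (A \<union> (+) m ` A') (B \<union> (+) m ` B')))"
      unfolding N by (subst sum_pattern_prob_renewal[OF m1]) simp
    also have "\<dots> = (\<Sum>A\<in>?P. \<Sum>A'\<in>Pow {1..n}. ?q m A * ?q n A' *
        (\<Sum>B\<in>?P. \<Sum>B'\<in>Pow {1..n}. ?q m B * ?q n B' * (of_bool (A \<inter> B = {m}) * (r * r ^ card (A' \<inter> B')))))"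
      by (intro sum.cong refl arg_cong2[where f="(*)"] F)
    also have "\<dots> = (\<Sum>A\<in>?P. \<Sum>A'\<in>Pow {1..n}. \<Sum>B\<in>?P. \<Sum>B'\<in>Pow {1..n}.
        (?q m A * ?q m B * of_bool (A \<inter> B = {m})) * (r * (?q n A' * ?q n B' * r ^ card (A' \<inter> B'))))"
      unfolding sum_distrib_left by (intro sum.cong refl) (simp only: mult_ac)
    also have "\<dots> = (\<Sum>A\<in>?P. \<Sum>B\<in>?P. \<Sum>A'\<in>Pow {1..n}. \<Sum>B'\<in>Pow {1..n}.
        (?q m A * ?q m B * of_bool (A \<inter> B = {m})) * (r * (?q n A' * ?q n B' * r ^ card (A' \<inter> B'))))"
      by (intro sum.cong refl sum.swap)
    also have "\<dots> = first_meeting_prob m * (r * overlap_moment r n)"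
      unfolding first_meeting_prob_def overlap_moment_def sum_times_sum by (simp only: sum_distrib_left)
    finally show ?thesis by (simp add: n_def mult.commute mult.left_commute)
  qed
  have "overlap_moment r N = (\<Sum>A\<in>Pow {1..N}. \<Sum>B\<in>Pow {1..N}. ?q N A * ?q N B * (of_bool (A \<inter> B = {})
      + (\<Sum>m=1..N. of_bool (A \<inter> B \<inter> {1..m} = {m}) * r ^ card (A \<inter> B))))"
    unfolding overlap_moment_def by (intro sum.cong refl arg_cong2[where f="(*)"] decomp)
  also have "\<dots> = (\<Sum>A\<in>Pow {1..N}. \<Sum>B\<in>Pow {1..N}. ?q N A * ?q N B * of_bool (A \<inter> B = {}))
     + (\<Sum>A\<in>Pow {1..N}. \<Sum>B\<in>Pow {1..N}. \<Sum>m=1..N. ?q N A * ?q N B * (of_bool (A \<inter> B \<inter> {1..m} = {m}) * r ^ card (A \<inter> B)))"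
    by (simp only: distrib_left sum.distrib sum_distrib_left)
  also have "(\<Sum>A\<in>Pow {1..N}. \<Sum>B\<in>Pow {1..N}. \<Sum>m=1..N. ?q N A * ?q N B * (of_bool (A \<inter> B \<inter> {1..m} = {m}) * r ^ card (A \<inter> B)))
     = (\<Sum>m=1..N. \<Sum>A\<in>Pow {1..N}. \<Sum>B\<in>Pow {1..N}. ?q N A * ?q N B * (of_bool (A \<inter> B \<inter> {1..m} = {m}) * r ^ card (A \<inter> B)))"
    by (subst sum.swap[of _ "{1..N}" "Pow {1..N}"]) (intro sum.cong refl sum.swap)
  also have "\<dots> = (\<Sum>m=1..N. r * first_meeting_prob m * overlap_moment r (N - m))"
    by (intro sum.cong refl term_eq)
  finally show ?thesis .
qed

text \<open>
  The bound is the fixed point \<open>C = 1 + r * p * C\<close> of the recursion at the first meeting, in which the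
  first meeting probabilities add up to at most the return probability \<open>p\<close>.
\<close>

lemma overlap_moment_le:
  assumes r: "0 \<le> r" "r * intersection_return_prob M \<tau> < 1"
  shows "overlap_moment r N \<le> 1 / (1 - r * intersection_return_prob M \<tau>)"
proof (induction N rule: less_induct)
  case (less N)
  let ?p = "intersection_return_prob M \<tau>"
  define C where "C = 1 / (1 - r * ?p)"
  have C: "0 \<le> C" "1 + r * ?p * C = C" using r by (auto simp: C_def field_simps)
  have "(\<Sum>A\<in>Pow {1..N}. \<Sum>B\<in>Pow {1..N}. pattern_prob N A * pattern_prob N B * of_bool (A \<inter> B = {}))
      \<le> (\<Sum>A\<in>Pow {1..N}. \<Sum>B\<in>Pow {1..N}. pattern_prob N A * pattern_prob N B)"
    by (intro sum_mono) auto
  also have "\<dots> = 1" by (simp only: sum_distrib_left[symmetric] sum_pattern_prob mult_1_right)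
  finally have 1: "(\<Sum>A\<in>Pow {1..N}. \<Sum>B\<in>Pow {1..N}. pattern_prob N A * pattern_prob N B * of_bool (A \<inter> B = {})) \<le> 1" .
  have "(\<Sum>m=1..N. r * first_meeting_prob m * overlap_moment r (N - m))
      \<le> (\<Sum>m=1..N. r * first_meeting_prob m * C)"
    by (intro sum_mono mult_left_mono mult_nonneg_nonneg r first_meeting_prob_nonneg)
      (auto simp: C_def intro!: less.IH)
  also have "\<dots> = r * C * (\<Sum>m=1..N. first_meeting_prob m)" by (simp add: sum_distrib_left mult_ac)
  also have "\<dots> \<le> r * C * ?p" using C(1) r(1) by (intro mult_left_mono sum_first_meeting_prob_le) auto
  finally have "overlap_moment r N \<le> 1 + r * C * ?p"
    using 1 overlap_moment_first_meeting[of r N] by simp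
  then show ?case using C(2) by (simp add: C_def mult_ac)
qed

end

section \<open>Strict monotonicity of the second-moment exponent\<close>

locale exponential_moments = prob_space P for P :: "'b measure" +
  fixes X :: "'b \<Rightarrow> real"
  assumes measurable_X [measurable]: "X \<in> borel_measurable P"
    and exp_integrable: "0 \<le> t \<Longrightarrow> integrable P (\<lambda>y. exp (t * X y))"
begin

definition mgf :: "real \<Rightarrow> real" where
  "mgf t = (\<integral>y. exp (t * X y) \<partial>P)"

lemma mgf_pos: "0 \<le> t \<Longrightarrow> 0 < mgf t"
proof -
  assume "0 \<le> t"
  then have "(\<integral>y. 0 \<partial>P) < (\<integral>y. exp (t * X y) \<partial>P)"
    by (intro integral_less_AE_space) (auto simp: exp_integrable emeasure_space_1)
  then show ?thesis by (simp add: mgf_def)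
qed

text \<open>
  Under the law tilted by \<open>exp (a * X)\<close>, this is the positive correlation of the two increasing
  functions \<open>exp (a * X)\<close> and \<open>exp ((b - a) * X)\<close>. Both of them are centred at their values at one
  common point \<open>t\<close>, so that the product of the differences is pointwise nonnegative; \<open>t\<close> is chosen to
  make \<open>exp (a * t)\<close> the tilted mean of \<open>exp (a * X)\<close>, which cancels the terms with
  \<open>exp ((b - a) * t)\<close>.
\<close>

lemma mgf_correlation:
  assumes ab: "0 \<le> a" "a \<le> b"
  shows "mgf (2 * a) * mgf b \<le> mgf (a + b) * mgf a"
proof (cases "a = 0")
  case False
  then have a: "0 < a" using ab by simp
  define t where "t = ln (mgf (2 * a) / mgf a) / a"
  define c where "c = exp (a * t)"
  define d where "d = exp ((b - a) * t)"
  have c: "c * mgf a = mgf (2 * a)"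
    using a mgf_pos[of a] mgf_pos[of "2 * a"] by (simp add: c_def t_def)
  have "0 \<le> (\<integral>y. exp (a * X y) * (exp (a * X y) - c) * (exp ((b - a) * X y) - d) \<partial>P)"
  proof (rule Bochner_Integration.integral_nonneg)
    fix y
    have "0 \<le> (exp (a * X y) - c) * (exp ((b - a) * X y) - d)"
    proof (cases "X y \<le> t")
      case True
      then have "exp (a * X y) \<le> c" "exp ((b - a) * X y) \<le> d"
        using ab by (simp_all add: c_def d_def mult_left_mono)
      then show ?thesis by (intro mult_nonpos_nonpos) auto
    next
      case False
      then have "c \<le> exp (a * X y)" "d \<le> exp ((b - a) * X y)"
        using ab by (simp_all add: c_def d_def mult_left_mono)
      then show ?thesis by (intro mult_nonneg_nonneg) auto
    qed
    then show "0 \<le> exp (a * X y) * (exp (a * X y) - c) * (exp ((b - a) * X y) - d)"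
      by (simp add: mult.assoc)
  qed
  also have "\<dots> = (\<integral>y. exp ((a + b) * X y) - c * exp (b * X y) - d * exp (2 * a * X y) + c * d * exp (a * X y) \<partial>P)"
  proof (rule Bochner_Integration.integral_cong[OF refl])
    fix y
    have 1: "exp ((a + b) * X y) = exp (a * X y) * exp (a * X y) * exp ((b - a) * X y)"
      by (simp add: exp_add[symmetric] algebra_simps)
    have 2: "exp (b * X y) = exp (a * X y) * exp ((b - a) * X y)"
      by (simp add: exp_add[symmetric] algebra_simps)
    have 3: "exp (2 * a * X y) = exp (a * X y) * exp (a * X y)"
      by (simp add: exp_add[symmetric] algebra_simps)
    show "exp (a * X y) * (exp (a * X y) - c) * (exp ((b - a) * X y) - d)
      = exp ((a + b) * X y) - c * exp (b * X y) - d * exp (2 * a * X y) + c * d * exp (a * X y)"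
      unfolding 1 2 3 by (simp add: algebra_simps)
  qed
  also have "\<dots> = mgf (a + b) - c * mgf b - d * mgf (2 * a) + c * d * mgf a"
    unfolding mgf_def using ab exp_integrable[of "a + b"] exp_integrable[of b] exp_integrable[of "2 * a"] exp_integrable[of a]
    by simp
  also have "\<dots> = mgf (a + b) - c * mgf b" using c by (simp add: mult.commute mult.left_commute)
  finally have "c * mgf b * mgf a \<le> mgf (a + b) * mgf a"
    using mgf_pos[of a] ab by (intro mult_right_mono) auto
  moreover have "c * mgf b * mgf a = (c * mgf a) * mgf b" by (simp only: mult_ac)
  ultimately show ?thesis unfolding c by simp
qed simp

text \<open>
  This is the Cauchy--Schwarz inequality for \<open>exp (s/2 * X)\<close> and \<open>exp (t/2 * X)\<close>; equality would make
  them proportional and \<open>X\<close> constant.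
\<close>

lemma mgf_strict_log_convex:
  assumes nondeg: "\<And>x. \<not> (AE y in P. X y = x)" and st: "0 \<le> s" "s < t"
  shows "(mgf ((s + t) / 2))\<^sup>2 < mgf s * mgf t"
proof -
  \<comment> \<open>The coefficient of the projection onto \<open>exp (s/2 * X)\<close>.\<close>
  define c where "c = mgf ((s + t) / 2) / mgf s"
  have ms: "0 < mgf s" using mgf_pos st by simp
  have c0: "0 < c" using ms mgf_pos[of "(s + t) / 2"] st by (simp add: c_def)
  let ?f = "\<lambda>y. (exp (t / 2 * X y) - c * exp (s / 2 * X y))\<^sup>2"
  have f: "?f y = exp (t * X y) - 2 * c * exp ((s + t) / 2 * X y) + c\<^sup>2 * exp (s * X y)" for y
    by (simp add: power2_eq_square algebra_simps exp_add[symmetric] add_divide_distrib)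
  have int: "integrable P ?f" unfolding f
    using st exp_integrable[of t] exp_integrable[of "(s + t) / 2"] exp_integrable[of s] by simp
  have val: "(\<integral>y. ?f y \<partial>P) = mgf t - 2 * c * mgf ((s + t) / 2) + c\<^sup>2 * mgf s"
    unfolding f mgf_def
    using st exp_integrable[of t] exp_integrable[of "(s + t) / 2"] exp_integrable[of s] by simp
  have "(\<integral>y. ?f y \<partial>P) \<noteq> 0"
  proof
    assume "(\<integral>y. ?f y \<partial>P) = 0"
    then have "AE y in P. ?f y = 0" using int by (subst (asm) integral_nonneg_eq_0_iff_AE) auto
    then have "AE y in P. X y = ln c / ((t - s) / 2)"
    proof eventually_elim
      case (elim y)
      then have "exp (t / 2 * X y) = c * exp (s / 2 * X y)" by simp
      then have "c = exp (t / 2 * X y) / exp (s / 2 * X y)" by simp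
      also have "\<dots> = exp ((t - s) / 2 * X y)"
        by (simp add: exp_diff[symmetric] diff_divide_distrib left_diff_distrib)
      finally have "ln c = (t - s) / 2 * X y" by simp
      then show ?case using st by (simp add: field_simps)
    qed
    then show False using nondeg by blast
  qed
  moreover have "0 \<le> (\<integral>y. ?f y \<partial>P)" by (rule Bochner_Integration.integral_nonneg) simp
  ultimately have "0 < mgf t - 2 * c * mgf ((s + t) / 2) + c\<^sup>2 * mgf s" using val by linarith
  also have "\<dots> = mgf t - (mgf ((s + t) / 2))\<^sup>2 / mgf s"
    using ms by (simp add: c_def power2_eq_square field_simps)
  finally show ?thesis using ms by (simp add: field_simps)
qed

text \<open>
  In terms of \<open>\<lambda> = ln mgf\<close>, the function \<open>\<lambda>(2\<beta>) - 2\<lambda>(\<beta>)\<close> is strictly increasing. Strict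
  convexity compares \<open>\<lambda>(2a) + \<lambda>(2b)\<close> with \<open>2\<lambda>(a + b)\<close>, and the correlation
  inequality compares \<open>\<lambda>(a + b) + \<lambda>(a)\<close> with \<open>\<lambda>(2a) + \<lambda>(b)\<close>.
\<close>

lemma mgf_ratio_strict_mono:
  assumes nondeg: "\<And>x. \<not> (AE y in P. X y = x)" and ab: "0 \<le> a" "a < b"
  shows "mgf (2 * a) / (mgf a)\<^sup>2 < mgf (2 * b) / (mgf b)\<^sup>2"
proof -
  have pos: "0 < mgf a" "0 < mgf b" "0 < mgf (2 * a)" "0 < mgf (2 * b)" "0 < mgf (a + b)"
    using ab by (auto intro!: mgf_pos)
  have 1: "(mgf (a + b))\<^sup>2 < mgf (2 * a) * mgf (2 * b)"
    using mgf_strict_log_convex[OF nondeg, of "2 * a" "2 * b"] ab by (simp add: add_divide_distrib)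
  have 2: "(mgf (2 * a) * mgf b)\<^sup>2 \<le> (mgf (a + b) * mgf a)\<^sup>2"
    using mgf_correlation[of a b] ab pos by (intro power_mono) auto
  have "mgf (2 * a) * (mgf (2 * a) * (mgf b)\<^sup>2) = (mgf (2 * a) * mgf b)\<^sup>2"
    by (simp add: power2_eq_square)
  also have "\<dots> \<le> (mgf (a + b))\<^sup>2 * (mgf a)\<^sup>2" using 2 by (simp add: power_mult_distrib)
  also have "\<dots> < (mgf (2 * a) * mgf (2 * b)) * (mgf a)\<^sup>2" using 1 pos by (intro mult_strict_right_mono) auto
  finally have "mgf (2 * a) * (mgf b)\<^sup>2 < mgf (2 * b) * (mgf a)\<^sup>2" using pos by (simp add: mult.assoc)
  then show ?thesis using pos by (simp add: field_simps)
qed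

end

section \<open>Almost sure convergence of martingales bounded in \<open>L\<^sup>2\<close>\<close>

lemma integrable_square_mult:
  fixes f g :: "'a \<Rightarrow> real"
  assumes [measurable]: "f \<in> borel_measurable M" "g \<in> borel_measurable M"
    and f: "integrable M (\<lambda>x. (f x)\<^sup>2)" and g: "integrable M (\<lambda>x. (g x)\<^sup>2)"
  shows "integrable M (\<lambda>x. f x * g x)"
proof (rule Bochner_Integration.integrable_bound)
  show "integrable M (\<lambda>x. (f x)\<^sup>2 + (g x)\<^sup>2)" using f g by simp
  have "\<bar>f x * g x\<bar> \<le> (f x)\<^sup>2 + (g x)\<^sup>2" for x
  proof -
    have "0 \<le> (\<bar>f x\<bar> - \<bar>g x\<bar>)\<^sup>2" by simp
    then have "2 * (\<bar>f x\<bar> * \<bar>g x\<bar>) \<le> (f x)\<^sup>2 + (g x)\<^sup>2" by (simp add: power2_diff)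
    moreover have "0 \<le> \<bar>f x\<bar> * \<bar>g x\<bar>" by simp
    ultimately show ?thesis unfolding abs_mult by linarith
  qed
  then show "AE x in M. norm (f x * g x) \<le> norm ((f x)\<^sup>2 + (g x)\<^sup>2)" by simp
qed simp

lemma integrable_square_add:
  fixes f g :: "'a \<Rightarrow> real"
  assumes "f \<in> borel_measurable M" "g \<in> borel_measurable M"
    and "integrable M (\<lambda>x. (f x)\<^sup>2)" and "integrable M (\<lambda>x. (g x)\<^sup>2)"
  shows "integrable M (\<lambda>x. (f x + g x)\<^sup>2)"
  using assms integrable_square_mult[OF assms] by (simp add: power2_sum mult.assoc)

text \<open>
  The martingale property is expressed by orthogonality: each increment is orthogonal in
  \<open>L\<^sup>2\<close> to every square-integrable function of the past. The sub-\<open>\<sigma>\<close>-algebras \<open>F n\<close> are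
  described only through the real functions that are measurable with respect to them.
\<close>

locale square_integrable_martingale = prob_space P for P :: "'b measure" +
  fixes F :: "nat \<Rightarrow> 'b measure" and Z :: "nat \<Rightarrow> 'b \<Rightarrow> real"
  assumes sub: "\<And>n f. f \<in> borel_measurable (F n) \<Longrightarrow> (f :: 'b \<Rightarrow> real) \<in> borel_measurable P"
    and mono: "\<And>n f. f \<in> borel_measurable (F n) \<Longrightarrow> (f :: 'b \<Rightarrow> real) \<in> borel_measurable (F (Suc n))"
    and adapted: "\<And>n. Z n \<in> borel_measurable (F n)"
    and square_int: "\<And>n. integrable P (\<lambda>y. (Z n y)\<^sup>2)"
    and orthogonal: "\<And>n f. f \<in> borel_measurable (F n) \<Longrightarrow> integrable P (\<lambda>y. (f y)\<^sup>2) \<Longrightarrow>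
      (\<integral>y. f y * (Z (Suc n) y - Z n y) \<partial>P) = 0"
begin

lemma mono_le: "n \<le> m \<Longrightarrow> f \<in> borel_measurable (F n) \<Longrightarrow> (f :: 'b \<Rightarrow> real) \<in> borel_measurable (F m)"
  by (induction m rule: dec_induct) (auto intro: mono)

lemma measurable_Z [measurable]: "Z n \<in> borel_measurable P"
  using sub adapted by blast

definition increment :: "nat \<Rightarrow> 'b \<Rightarrow> real" where
  "increment n y = Z (Suc n) y - Z n y"

lemma measurable_increment [measurable]: "increment n \<in> borel_measurable P"
  unfolding increment_def[abs_def] by measurable

lemma square_int_increment: "integrable P (\<lambda>y. (increment n y)\<^sup>2)"
  using integrable_square_add[of "Z (Suc n)" P "\<lambda>y. - Z n y"] square_int by (simp add: increment_def)

lemma sum_Z: "a \<le> K \<Longrightarrow> (\<Sum>n=a..<K. increment n y) = Z K y - Z a y"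
  by (induction K rule: dec_induct) (auto simp: increment_def)

text \<open>
  The variance of a martingale transform is additive since the factor \<open>W K * I K\<close> is known at time
  \<open>K\<close>, and so the mixed term with the next increment vanishes.
\<close>

lemma transform_variance:
  fixes I :: "nat \<Rightarrow> 'b \<Rightarrow> real"
  assumes I: "\<And>n. a \<le> n \<Longrightarrow> I n \<in> borel_measurable (F n)" "\<And>n y. \<bar>I n y\<bar> \<le> 1" and aK: "a \<le> K"
  defines "W \<equiv> (\<lambda>K y. \<Sum>n=a..<K. I n y * increment n y)"
  shows "W K \<in> borel_measurable (F K)" "integrable P (\<lambda>y. (W K y)\<^sup>2)"
    "(\<integral>y. (W K y)\<^sup>2 \<partial>P) = (\<Sum>n=a..<K. \<integral>y. (I n y * increment n y)\<^sup>2 \<partial>P)"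
  using aK
proof (induction K rule: dec_induct)
  case base
  { case 1 show ?case by (simp add: W_def)
  next case 2 show ?case by (simp add: W_def)
  next case 3 show ?case by (simp add: W_def) }
next
  case (step K)
  have WS: "W (Suc K) y = W K y + I K y * increment K y" for y using step by (simp add: W_def)
  have mI: "I K \<in> borel_measurable (F K)" using I step by simp
  note [measurable] = sub[OF mI] sub[OF step.IH(1)]
  have bd: "integrable P (\<lambda>y. (I K y * g y)\<^sup>2)" if "integrable P (\<lambda>y. (g y)\<^sup>2)" "g \<in> borel_measurable P" for g
  proof (rule Bochner_Integration.integrable_bound[OF that(1)])
    show "(\<lambda>y. (I K y * g y)\<^sup>2) \<in> borel_measurable P" using that(2) by measurable
    have "(I K y)\<^sup>2 \<le> 1" for y using I(2)[of K y] by (simp add: abs_square_le_1)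
    then show "AE y in P. norm ((I K y * g y)\<^sup>2) \<le> norm ((g y)\<^sup>2)"
      by (auto simp: power_mult_distrib intro!: mult_left_le_one_le)
  qed
  have mZ: "increment K \<in> borel_measurable (F (Suc K))"
    unfolding increment_def[abs_def] using adapted[of "Suc K"] mono[OF adapted[of K]] by measurable
  { case 1
    show ?case unfolding WS[abs_def] using mono[OF step.IH(1)] mono[OF mI] mZ by measurable
  next
    case 2
    show ?case unfolding WS by (intro integrable_square_add bd step.IH square_int_increment) measurable
  next
    case 3
    have cross0: "(\<integral>y. (W K y * I K y) * increment K y \<partial>P) = 0"
      unfolding increment_def
    proof (rule orthogonal)
      show "(\<lambda>y. W K y * I K y) \<in> borel_measurable (F K)" using step.IH(1) mI by measurable
      show "integrable P (\<lambda>y. (W K y * I K y)\<^sup>2)"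
        using bd[OF step.IH(2)] by (simp add: mult.commute)
    qed
    have cross_int: "integrable P (\<lambda>y. W K y * (I K y * increment K y))"
      by (intro integrable_square_mult bd step.IH square_int_increment) measurable
    have "(\<integral>y. (W (Suc K) y)\<^sup>2 \<partial>P) = (\<integral>y. (W K y)\<^sup>2 + (I K y * increment K y)\<^sup>2 + 2 * (W K y * (I K y * increment K y)) \<partial>P)"
      unfolding WS by (simp add: power2_sum mult.assoc)
    also have "\<dots> = (\<integral>y. (W K y)\<^sup>2 \<partial>P) + (\<integral>y. (I K y * increment K y)\<^sup>2 \<partial>P) + 2 * (\<integral>y. W K y * (I K y * increment K y) \<partial>P)"
      using step.IH(2) bd[OF square_int_increment] cross_int by simp
    also have "\<dots> = (\<integral>y. (W K y)\<^sup>2 \<partial>P) + (\<integral>y. (I K y * increment K y)\<^sup>2 \<partial>P)"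
      using cross0 by (simp add: mult.assoc)
    finally show ?case using step by simp }
qed

text \<open>
  Stopping at the first time at which the deviation reaches \<open>e\<close> is a martingale transform with the
  indicators \<open>I n\<close>. The stopped process \<open>W K\<close> retains a deviation of at least \<open>e\<close> once it has occurred,
  so that Chebyshev's inequality at the single time \<open>K\<close> suffices.
\<close>

lemma maximal_inequality:
  assumes e: "0 < e" and aK: "a \<le> K"
  shows "prob {y \<in> space P. \<exists>m\<in>{a..K}. e \<le> \<bar>Z m y - Z a y\<bar>}
    \<le> (\<Sum>n=a..<K. \<integral>y. (increment n y)\<^sup>2 \<partial>P) / e\<^sup>2"
proof -
  define I :: "nat \<Rightarrow> 'b \<Rightarrow> real" where
    "I n y = (if \<forall>m\<in>{a..n}. \<bar>Z m y - Z a y\<bar> < e then 1 else 0)" for n y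
  define W where "W K y = (\<Sum>n=a..<K. I n y * increment n y)" for K y
  have I_meas: "I n \<in> borel_measurable (F n)" if "a \<le> n" for n
  proof -
    have [measurable]: "Z m \<in> borel_measurable (F n)" if "m \<le> n" for m
      using mono_le[OF that adapted] .
    have [measurable]: "Measurable.pred (F n) (\<lambda>y. \<forall>m\<in>{a..n}. \<bar>Z m y - Z a y\<bar> < e)"
      using that by (intro pred_intros_finite) auto
    show ?thesis unfolding I_def[abs_def] by measurable
  qed
  have I_abs: "\<bar>I n y\<bar> \<le> 1" for n y by (simp add: I_def)
  have W: "W K \<in> borel_measurable (F K)" "integrable P (\<lambda>y. (W K y)\<^sup>2)"
      "(\<integral>y. (W K y)\<^sup>2 \<partial>P) = (\<Sum>n=a..<K. \<integral>y. (I n y * increment n y)\<^sup>2 \<partial>P)"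
    unfolding W_def[abs_def] using transform_variance[of a I K, OF I_meas I_abs aK] by simp_all
  note [measurable] = sub[OF W(1)]
  have run: "W k y = Z k y - Z a y" if "a \<le> k" "\<forall>m\<in>{a..<k}. \<bar>Z m y - Z a y\<bar> < e" for k y
  proof -
    have "W k y = (\<Sum>n=a..<k. increment n y)"
      unfolding W_def using that by (intro sum.cong) (auto simp: I_def)
    then show ?thesis using sum_Z[OF that(1)] by simp
  qed
  have stop: "e \<le> \<bar>W K y\<bar>" if m: "m \<in> {a..K}" "e \<le> \<bar>Z m y - Z a y\<bar>" for m y
  proof -
    define T where "T = (LEAST m. a \<le> m \<and> e \<le> \<bar>Z m y - Z a y\<bar>)"
    have T: "a \<le> T \<and> e \<le> \<bar>Z T y - Z a y\<bar>" unfolding T_def by (rule LeastI[of _ m]) (use m in auto)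
    have "T \<le> m" unfolding T_def by (rule Least_le) (use m in auto)
    then have TK: "T \<le> K" using m by auto
    have before: "\<bar>Z j y - Z a y\<bar> < e" if "j \<in> {a..<T}" for j
      using not_less_Least[of j "\<lambda>m. a \<le> m \<and> e \<le> \<bar>Z m y - Z a y\<bar>"] that by (auto simp: T_def)
    have "W K y = W T y"
      unfolding W_def
    proof (rule sum.mono_neutral_right)
      show "\<forall>i\<in>{a..<K} - {a..<T}. I i y * increment i y = 0"
        using T by (force simp: I_def)
    qed (use TK in auto)
    then show ?thesis using run[of T y] T before by auto
  qed
  have "prob {y \<in> space P. \<exists>m\<in>{a..K}. e \<le> \<bar>Z m y - Z a y\<bar>} \<le> prob {y \<in> space P. e\<^sup>2 \<le> (W K y)\<^sup>2}"
  proof (rule finite_measure_mono)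
    show "{y \<in> space P. \<exists>m\<in>{a..K}. e \<le> \<bar>Z m y - Z a y\<bar>} \<subseteq> {y \<in> space P. e\<^sup>2 \<le> (W K y)\<^sup>2}"
      using stop e by (auto intro!: abs_le_square_iff[THEN iffD1])
  qed measurable
  also have "\<dots> \<le> (\<integral>y. (W K y)\<^sup>2 \<partial>P) / e\<^sup>2"
    using e W(2) by (intro integral_Markov_inequality_measure[where A="{}"]) auto
  also have "\<dots> \<le> (\<Sum>n=a..<K. \<integral>y. (increment n y)\<^sup>2 \<partial>P) / e\<^sup>2"
  proof (intro divide_right_mono)
    have "(\<integral>y. (I n y * increment n y)\<^sup>2 \<partial>P) \<le> (\<integral>y. (increment n y)\<^sup>2 \<partial>P)" for n
      by (rule integral_mono_AE') (auto simp: I_def square_int_increment)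
    then show "(\<integral>y. (W K y)\<^sup>2 \<partial>P) \<le> (\<Sum>n=a..<K. \<integral>y. (increment n y)\<^sup>2 \<partial>P)"
      unfolding W(3) by (intro sum_mono)
  qed simp
  finally show ?thesis .
qed

text \<open>
  The second moments of the increments are summable. By the maximal inequality, the fluctuation after
  time \<open>a\<close> exceeds \<open>e\<close> with a probability that vanishes with the tail of this series, so almost every
  path is Cauchy.
\<close>

lemma AE_convergent:
  assumes bound: "\<And>n. (\<integral>y. (Z n y)\<^sup>2 \<partial>P) \<le> C"
  shows "AE y in P. convergent (\<lambda>n. Z n y)"
proof -
  define v where "v n = (\<integral>y. (increment n y)\<^sup>2 \<partial>P)" for n
  have v0: "0 \<le> v n" for n by (simp add: v_def)
  have vsum: "(\<Sum>n<K. v n) \<le> 2 * C + 2 * C" for K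
  proof -
    have "(\<Sum>n<K. v n) = (\<integral>y. (\<Sum>n=0..<K. 1 * increment n y)\<^sup>2 \<partial>P)"
      using transform_variance(3)[of 0 "\<lambda>_ _. 1" K] by (simp add: v_def atLeast0LessThan)
    also have "\<dots> = (\<integral>y. (Z K y - Z 0 y)\<^sup>2 \<partial>P)" by (simp add: sum_Z)
    also have "\<dots> \<le> (\<integral>y. 2 * (Z K y)\<^sup>2 + 2 * (Z 0 y)\<^sup>2 \<partial>P)"
    proof (rule integral_mono_AE')
      show "AE y in P. (Z K y - Z 0 y)\<^sup>2 \<le> 2 * (Z K y)\<^sup>2 + 2 * (Z 0 y)\<^sup>2"
      proof (rule AE_I2)
        fix y
        have "0 \<le> (Z K y + Z 0 y)\<^sup>2" by simp
        then show "(Z K y - Z 0 y)\<^sup>2 \<le> 2 * (Z K y)\<^sup>2 + 2 * (Z 0 y)\<^sup>2"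
          by (simp add: power2_sum power2_diff)
      qed
    qed (use square_int in auto)
    also have "\<dots> = 2 * (\<integral>y. (Z K y)\<^sup>2 \<partial>P) + 2 * (\<integral>y. (Z 0 y)\<^sup>2 \<partial>P)" using square_int by simp
    also have "\<dots> \<le> 2 * C + 2 * C" using bound by (intro add_mono mult_left_mono) auto
    finally show ?thesis .
  qed
  have sv: "summable v" using summableI_nonneg_bounded[of v, OF v0 vsum] .
  have tail: "(\<lambda>a. \<Sum>n. v (n + a)) \<longlonglongrightarrow> 0"
    using suminf_exist_split2[OF sv] by simp
  have osc: "AE y in P. \<exists>a. \<forall>m\<ge>a. \<bar>Z m y - Z a y\<bar> < e" if e: "0 < e" for e :: real
  proof -
    let ?B = "\<lambda>a K. {y \<in> space P. \<exists>m\<in>{a..K}. e \<le> \<bar>Z m y - Z a y\<bar>}"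
    let ?U = "\<lambda>a. {y \<in> space P. \<exists>m\<ge>a. e \<le> \<bar>Z m y - Z a y\<bar>}"
    have U: "prob (?U a) \<le> (\<Sum>n. v (n + a)) / e\<^sup>2" for a
    proof (rule LIMSEQ_le_const2)
      have "(\<lambda>k. prob (?B a (a + k))) \<longlonglongrightarrow> prob (\<Union>k. ?B a (a + k))"
        by (intro finite_Lim_measure_incseq incseq_SucI) auto
      moreover have "(\<Union>k. ?B a (a + k)) = ?U a"
      proof (intro equalityI subsetI)
        fix y assume "y \<in> ?U a"
        then obtain m where "y \<in> space P" "a \<le> m" "e \<le> \<bar>Z m y - Z a y\<bar>" by auto
        then have "y \<in> ?B a (a + (m - a))" by auto
        then show "y \<in> (\<Union>k. ?B a (a + k))" by blast
      qed auto
      ultimately show "(\<lambda>k. prob (?B a (a + k))) \<longlonglongrightarrow> prob (?U a)" by simp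
      have "prob (?B a (a + k)) \<le> (\<Sum>n. v (n + a)) / e\<^sup>2" for k
      proof -
        have "(\<Sum>n=a..<a+k. v n) = (\<Sum>n<k. v (n + a))"
          using sum.shift_bounds_nat_ivl[of v 0 a k] by (simp add: atLeast0LessThan add.commute)
        also have "\<dots> \<le> (\<Sum>n. v (n + a))"
          using sv v0 by (intro sum_le_suminf) (auto simp: summable_iff_shift)
        finally have "(\<Sum>n=a..<a+k. v n) / e\<^sup>2 \<le> (\<Sum>n. v (n + a)) / e\<^sup>2" by (intro divide_right_mono) auto
        then show ?thesis using maximal_inequality[OF e, of a "a + k"] by (simp add: v_def)
      qed
      then show "\<exists>N. \<forall>n\<ge>N. prob (?B a (a + n)) \<le> (\<Sum>n. v (n + a)) / e\<^sup>2" by blast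
    qed
    have "prob (\<Inter>a. ?U a) \<le> (\<Sum>n. v (n + a)) / e\<^sup>2" for a
      using U[of a] finite_measure_mono[of "\<Inter>a. ?U a" "?U a"] by fastforce
    moreover have "(\<lambda>a. (\<Sum>n. v (n + a)) / e\<^sup>2) \<longlonglongrightarrow> 0" using tendsto_divide_zero[OF tail] by simp
    ultimately have "prob (\<Inter>a. ?U a) \<le> 0" by (intro LIMSEQ_le_const) auto
    then have "prob (\<Inter>a. ?U a) = 0" using measure_nonneg[of P] by (intro antisym) auto
    then have "AE y in P. y \<notin> (\<Inter>a. ?U a)"
      by (intro AE_not_in) (auto simp: emeasure_eq_measure null_sets_def)
    then show ?thesis using AE_space by eventually_elim (auto, metis not_le)
  qed
  have "AE y in P. \<forall>j::nat. \<exists>a. \<forall>m\<ge>a. \<bar>Z m y - Z a y\<bar> < 1 / Suc j"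
    by (intro AE_all_countable[THEN iffD2] allI osc) simp
  then show ?thesis
  proof eventually_elim
    case (elim y)
    have "Cauchy (\<lambda>n. Z n y)"
    proof (rule metric_CauchyI)
      fix e :: real assume "0 < e"
      then obtain j where j: "1 / Suc j < e / 2" using reals_Archimedean[of "e / 2"] by (auto simp: field_simps)
      obtain a where a: "\<And>m. m \<ge> a \<Longrightarrow> \<bar>Z m y - Z a y\<bar> < 1 / Suc j" using elim by blast
      have "dist (Z m y) (Z n y) < e" if "m \<ge> a" "n \<ge> a" for m n
        using a[OF that(1)] a[OF that(2)] j by (simp add: dist_real_def)
      then show "\<exists>M. \<forall>m\<ge>M. \<forall>n\<ge>M. dist (Z m y) (Z n y) < e" by blast
    qed
    then show ?case by (rule Cauchy_convergent)
  qed
qed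

end

section \<open>Partition functions with independent weights\<close>

text \<open>
  The weight \<open>\<zeta> n\<close> plays the role of \<open>exp (\<beta> * \<omega>\<^sub>n - \<lambda>(\<beta>))\<close>, whose second moment is
  \<open>exp (\<lambda>(2\<beta>) - 2\<lambda>(\<beta>))\<close>.
\<close>

locale random_weights = prob_space P for P :: "'b measure" +
  fixes \<zeta> :: "nat \<Rightarrow> 'b \<Rightarrow> real" and r :: real
  assumes weights_indep: "indep_vars (\<lambda>_. borel) \<zeta> {1..}"
    and weights_pos: "0 < \<zeta> n y"
    and weights_int: "1 \<le> n \<Longrightarrow> integrable P (\<zeta> n)"
    and weights_mean: "1 \<le> n \<Longrightarrow> (\<integral>y. \<zeta> n y \<partial>P) = 1"
    and weights_sq_int: "1 \<le> n \<Longrightarrow> integrable P (\<lambda>y. (\<zeta> n y)\<^sup>2)"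
    and weights_sq: "1 \<le> n \<Longrightarrow> (\<integral>y. (\<zeta> n y)\<^sup>2 \<partial>P) = r"
begin

lemma measurable_weight: "1 \<le> n \<Longrightarrow> \<zeta> n \<in> borel_measurable P"
  using weights_int by (simp add: borel_measurable_integrable)

text \<open>
  A weight in exactly one of the two sets contributes its mean \<open>1\<close>, a weight in both its second moment
  \<open>r\<close>.
\<close>

lemma prod_weights_pair:
  assumes A: "finite A" "A \<subseteq> {1..}" and B: "finite B" "B \<subseteq> {1..}"
  shows "integrable P (\<lambda>y. (\<Prod>n\<in>A. \<zeta> n y) * (\<Prod>n\<in>B. \<zeta> n y))"
    and "(\<integral>y. (\<Prod>n\<in>A. \<zeta> n y) * (\<Prod>n\<in>B. \<zeta> n y) \<partial>P) = r ^ card (A \<inter> B)"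
proof -
  define e where "e n = (if n \<in> A \<inter> B then 2 else 1 :: nat)" for n
  have eq: "(\<Prod>n\<in>A. \<zeta> n y) * (\<Prod>n\<in>B. \<zeta> n y) = (\<Prod>n\<in>A \<union> B. \<zeta> n y ^ e n)" for y
  proof -
    have "(\<Prod>n\<in>A \<union> B. \<zeta> n y ^ e n) = (\<Prod>n\<in>A \<union> B. \<zeta> n y ^ of_bool (n \<in> A)) * (\<Prod>n\<in>A \<union> B. \<zeta> n y ^ of_bool (n \<in> B))"
      unfolding prod.distrib[symmetric] power_add[symmetric]
      by (rule prod.cong) (auto simp: e_def power2_eq_square)
    also have "(\<Prod>n\<in>A \<union> B. \<zeta> n y ^ of_bool (n \<in> A)) = (\<Prod>n\<in>A. \<zeta> n y)"
      using A B by (intro prod.mono_neutral_cong_right) auto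
    also have "(\<Prod>n\<in>A \<union> B. \<zeta> n y ^ of_bool (n \<in> B)) = (\<Prod>n\<in>B. \<zeta> n y)"
      using A B by (intro prod.mono_neutral_cong_right) auto
    finally show ?thesis by simp
  qed
  have ind: "indep_vars (\<lambda>_. borel) (\<lambda>n y. \<zeta> n y ^ e n) (A \<union> B)"
    using A B by (intro indep_vars_compose2[OF indep_vars_subset[OF weights_indep]]) auto
  have int: "integrable P (\<lambda>y. \<zeta> n y ^ e n)" if "n \<in> A \<union> B" for n
    using that A B weights_int weights_sq_int by (auto simp: e_def)
  have val: "(\<integral>y. \<zeta> n y ^ e n \<partial>P) = (if n \<in> A \<inter> B then r else 1)" if "n \<in> A \<union> B" for n
  proof -
    have "1 \<le> n" using that A B by auto
    then show ?thesis using weights_mean weights_sq by (auto simp: e_def)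
  qed
  have fin: "finite (A \<union> B)" using A B by simp
  show "integrable P (\<lambda>y. (\<Prod>n\<in>A. \<zeta> n y) * (\<Prod>n\<in>B. \<zeta> n y))"
    unfolding eq by (rule indep_vars_integrable[OF fin ind int])
  have "(\<integral>y. (\<Prod>n\<in>A \<union> B. \<zeta> n y ^ e n) \<partial>P) = (\<Prod>n\<in>A \<union> B. \<integral>y. \<zeta> n y ^ e n \<partial>P)"
    by (rule indep_vars_lebesgue_integral[OF fin ind int])
  also have "\<dots> = (\<Prod>n\<in>A \<union> B. if n \<in> A \<inter> B then r else 1)"
    by (rule prod.cong[OF refl val])
  also have "\<dots> = (\<Prod>n\<in>A \<inter> B. r)"
    using fin by (intro prod.mono_neutral_cong_right) auto
  also have "\<dots> = r ^ card (A \<inter> B)" by simp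
  finally show "(\<integral>y. (\<Prod>n\<in>A. \<zeta> n y) * (\<Prod>n\<in>B. \<zeta> n y) \<partial>P) = r ^ card (A \<inter> B)"
    unfolding eq .
qed

lemma prod_weights:
  assumes A: "finite A" "A \<subseteq> {1..}"
  shows "integrable P (\<lambda>y. \<Prod>n\<in>A. \<zeta> n y)" and "(\<integral>y. (\<Prod>n\<in>A. \<zeta> n y) \<partial>P) = 1"
  using prod_weights_pair[OF A, of "{}"] by simp_all

definition history :: "nat \<Rightarrow> 'b measure" where
  "history n = vimage_algebra (space P) (\<lambda>y. \<lambda>i\<in>{1..n}. \<zeta> i y) (\<Pi>\<^sub>M i\<in>{1..n}. borel)"

lemma measurable_weight_history: "i \<in> {1..n} \<Longrightarrow> \<zeta> i \<in> borel_measurable (history n)"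
proof -
  assume i: "i \<in> {1..n}"
  have "(\<lambda>y. (\<lambda>i\<in>{1..n}. \<zeta> i y) i) \<in> borel_measurable (history n)"
    unfolding history_def using i
    by (intro measurable_compose[OF measurable_vimage_algebra1 measurable_component_singleton]) (auto simp: space_PiM)
  then show ?thesis using i by simp
qed

text \<open>
  The history is the coarsest \<open>\<sigma>\<close>-algebra that makes the first \<open>n\<close> weights measurable.
\<close>

lemma measurable_from_history:
  assumes Q: "space Q = space P" "\<And>i. i \<in> {1..n} \<Longrightarrow> \<zeta> i \<in> borel_measurable Q"
    and f: "f \<in> borel_measurable (history n)"
  shows "(f :: 'b \<Rightarrow> real) \<in> borel_measurable Q"
proof -
  have "id \<in> measurable Q (history n)"
    unfolding history_def
    by (rule measurable_vimage_algebra2) (auto simp: Q(1) intro!: measurable_restrict Q(2))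
  then show ?thesis using measurable_comp[OF _ f, of id Q] by simp
qed

lemma space_history: "space (history n) = space P"
  by (simp add: history_def)

text \<open>
  Both sides generate sub-\<open>\<sigma>\<close>-algebras of those generated by disjoint blocks of the weights.
\<close>

lemma history_indep_next:
  assumes g: "(g :: 'b \<Rightarrow> real) \<in> borel_measurable (history n)"
  shows "indep_var borel g borel (\<lambda>y. \<zeta> (Suc n) y - 1)"
proof -
  let ?R = "\<lambda>y. \<lambda>i\<in>{1..n}. \<zeta> i y" and ?R' = "\<lambda>y. \<lambda>i\<in>{Suc n}. \<zeta> i y"
  have "indep_var (\<Pi>\<^sub>M i\<in>{1..n}. borel) ?R (\<Pi>\<^sub>M i\<in>{Suc n}. borel) ?R'"
    by (rule indep_var_restrict[OF weights_indep]) auto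
  then have *: "indep_set (sigma_sets (space P) {?R -` A \<inter> space P | A. A \<in> sets (\<Pi>\<^sub>M i\<in>{1..n}. borel)})
      (sigma_sets (space P) {?R' -` A \<inter> space P | A. A \<in> sets (\<Pi>\<^sub>M i\<in>{Suc n}. borel)})"
    unfolding indep_var_eq by blast
  have gP: "random_variable borel g"
    by (rule measurable_from_history[OF refl _ g]) (auto intro: measurable_weight)
  have past: "{g -` A \<inter> space P | A. A \<in> sets borel} \<subseteq> {?R -` A \<inter> space P | A. A \<in> sets (\<Pi>\<^sub>M i\<in>{1..n}. borel)}"
  proof safe
    fix A :: "real set" assume "A \<in> sets borel"
    then have "g -` A \<inter> space P \<in> sets (history n)"
      using measurable_sets[OF g] by (simp add: space_history)
    then show "\<exists>B. g -` A \<inter> space P = ?R -` B \<inter> space P \<and> B \<in> sets (\<Pi>\<^sub>M i\<in>{1..n}. borel)"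
      unfolding history_def by (subst (asm) sets_vimage_algebra2) (auto simp: space_PiM)
  qed
  let ?h = "\<lambda>v. v (Suc n) - 1 :: real"
  have present: "{(\<lambda>y. \<zeta> (Suc n) y - 1) -` A \<inter> space P | A. A \<in> sets borel}
      \<subseteq> {?R' -` A \<inter> space P | A. A \<in> sets (\<Pi>\<^sub>M i\<in>{Suc n}. borel)}"
  proof safe
    fix A :: "real set" assume A: "A \<in> sets borel"
    have "?h \<in> borel_measurable (\<Pi>\<^sub>M i\<in>{Suc n}. borel)" by measurable
    from measurable_sets[OF this A]
    show "\<exists>B. (\<lambda>y. \<zeta> (Suc n) y - 1) -` A \<inter> space P = ?R' -` B \<inter> space P \<and> B \<in> sets (\<Pi>\<^sub>M i\<in>{Suc n}. borel)"
      by (intro exI[of _ "?h -` A \<inter> space (\<Pi>\<^sub>M i\<in>{Suc n}. borel)"]) (auto simp: space_PiM)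
  qed
  have "indep_set (sigma_sets (space P) {g -` A \<inter> space P | A. A \<in> sets borel})
      (sigma_sets (space P) {(\<lambda>y. \<zeta> (Suc n) y - 1) -` A \<inter> space P | A. A \<in> sets borel})"
    using * sigma_sets_mono'[OF past, of "space P"] sigma_sets_mono'[OF present, of "space P"]
    unfolding indep_set_def by (elim indep_sets_mono_sets) (simp split: bool.split)
  moreover have "random_variable borel (\<lambda>y. \<zeta> (Suc n) y - 1)"
    using measurable_weight[of "Suc n"] by simp
  ultimately show ?thesis using gP unfolding indep_var_eq by blast
qed

end

locale disordered_renewal = iid_renewal M \<tau> + env: random_weights P \<zeta> r
  for M :: "'a measure" and \<tau> and P :: "'b measure" and \<zeta> r
begin

definition Z :: "nat \<Rightarrow> 'b \<Rightarrow> real" where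
  "Z N y = (\<Sum>A\<in>Pow {1..N}. pattern_prob N A * (\<Prod>n\<in>A. \<zeta> n y))"

lemma Z_nonneg: "0 \<le> Z N y"
  unfolding Z_def by (intro sum_nonneg mult_nonneg_nonneg prod_nonneg) (auto intro: less_imp_le env.weights_pos)

lemma pow_props: "A \<in> Pow {1..N::nat} \<Longrightarrow> finite A" "A \<in> Pow {1..N::nat} \<Longrightarrow> A \<subseteq> {1..}"
  by (auto intro: finite_subset)

lemma Z_mean: "integrable P (Z N)" "(\<integral>y. Z N y \<partial>P) = 1"
proof -
  have int: "integrable P (\<lambda>y. pattern_prob N A * (\<Prod>n\<in>A. \<zeta> n y))" if "A \<in> Pow {1..N}" for A
    by (intro integrable_mult_right env.prod_weights pow_props[OF that])
  show "integrable P (Z N)" unfolding Z_def[abs_def] by (intro Bochner_Integration.integrable_sum int)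
  have "(\<integral>y. Z N y \<partial>P) = (\<Sum>A\<in>Pow {1..N}. \<integral>y. pattern_prob N A * (\<Prod>n\<in>A. \<zeta> n y) \<partial>P)"
    unfolding Z_def by (rule Bochner_Integration.integral_sum[OF int])
  also have "\<dots> = (\<Sum>A\<in>Pow {1..N}. pattern_prob N A)"
    by (intro sum.cong refl) (simp only: integral_mult_right_zero env.prod_weights(2)[OF pow_props] mult_1_right)
  finally show "(\<integral>y. Z N y \<partial>P) = 1" by (simp only: sum_pattern_prob)
qed

text \<open>
  The square is a double sum over the patterns of two independent copies of the renewal process in the
  same environment.
\<close>

lemma Z_second_moment: "integrable P (\<lambda>y. (Z N y)\<^sup>2)" "(\<integral>y. (Z N y)\<^sup>2 \<partial>P) = overlap_moment r N"
proof -
  have sq: "(Z N y)\<^sup>2 = (\<Sum>A\<in>Pow {1..N}. \<Sum>B\<in>Pow {1..N}.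
      pattern_prob N A * pattern_prob N B * ((\<Prod>n\<in>A. \<zeta> n y) * (\<Prod>n\<in>B. \<zeta> n y)))" for y
    unfolding Z_def power2_eq_square sum_product by (intro sum.cong refl) (simp only: mult_ac)
  have int: "integrable P (\<lambda>y. pattern_prob N A * pattern_prob N B * ((\<Prod>n\<in>A. \<zeta> n y) * (\<Prod>n\<in>B. \<zeta> n y)))"
    if "A \<in> Pow {1..N}" "B \<in> Pow {1..N}" for A B
    by (intro integrable_mult_right env.prod_weights_pair pow_props[OF that(1)] pow_props[OF that(2)])
  show "integrable P (\<lambda>y. (Z N y)\<^sup>2)" unfolding sq by (intro Bochner_Integration.integrable_sum int)
  have "(\<integral>y. (Z N y)\<^sup>2 \<partial>P) = (\<Sum>A\<in>Pow {1..N}. \<Sum>B\<in>Pow {1..N}.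
      \<integral>y. pattern_prob N A * pattern_prob N B * ((\<Prod>n\<in>A. \<zeta> n y) * (\<Prod>n\<in>B. \<zeta> n y)) \<partial>P)"
    unfolding sq
    by (subst Bochner_Integration.integral_sum, intro Bochner_Integration.integrable_sum int, assumption, assumption)
      (intro sum.cong refl Bochner_Integration.integral_sum int)
  also have "\<dots> = overlap_moment r N"
    unfolding overlap_moment_def
    by (intro sum.cong refl) (simp only: integral_mult_right_zero env.prod_weights_pair(2)[OF pow_props pow_props])
  finally show "(\<integral>y. (Z N y)\<^sup>2 \<partial>P) = overlap_moment r N" .
qed

lemma pattern_prob_Suc:
  assumes A: "A \<subseteq> {1..n}"
  shows "pattern_prob n A = pattern_prob (Suc n) A + pattern_prob (Suc n) (insert (Suc n) A)"
proof -
  let ?E = "\<lambda>n A. {x \<in> space M. renewal_set \<tau> x \<inter> {1..n} = A}"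
  have E: "?E n A \<in> events" for n A by measurable
  have I: "{1..Suc n} = insert (Suc n) {1..n}" by auto
  have "?E n A = ?E (Suc n) A \<union> ?E (Suc n) (insert (Suc n) A)"
  proof -
    have "R \<inter> {1..n} = A \<longleftrightarrow> R \<inter> {1..Suc n} = A \<or> R \<inter> {1..Suc n} = insert (Suc n) A" for R
    proof (cases "Suc n \<in> R")
      case True
      moreover have "Suc n \<notin> R \<inter> {1..n}" "Suc n \<notin> A" using A by auto
      ultimately show ?thesis unfolding I Int_insert_right by (metis insertI1 insert_ident)
    next
      case False
      then show ?thesis unfolding I Int_insert_right by (metis IntD1 insertI1)
    qed
    then show ?thesis by auto
  qed
  moreover have "?E (Suc n) A \<inter> ?E (Suc n) (insert (Suc n) A) = {}" using A by auto
  ultimately show ?thesis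
    unfolding pattern_prob_def using finite_measure_Union[OF E E] by presburger
qed

text \<open>
  This is the part of the partition function up to \<open>n\<close> that comes from the paths that renew at
  \<open>Suc n\<close>; only these feel the next weight.
\<close>

definition pinned_Z :: "nat \<Rightarrow> 'b \<Rightarrow> real" where
  "pinned_Z n y = (\<Sum>A\<in>Pow {1..n}. pattern_prob (Suc n) (insert (Suc n) A) * (\<Prod>i\<in>A. \<zeta> i y))"

lemma Z_Suc: "Z (Suc n) y - Z n y = pinned_Z n y * (\<zeta> (Suc n) y - 1)"
proof -
  let ?W = "\<lambda>A. \<Prod>i\<in>A. \<zeta> i y" and ?q = "pattern_prob (Suc n)"
  have I: "{1..Suc n} = insert (Suc n) {1..n}" by auto
  have inj: "inj_on (insert (Suc n)) (Pow {1..n})"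
  proof (rule inj_onI)
    fix A B assume *: "A \<in> Pow {1..n}" "B \<in> Pow {1..n}" "insert (Suc n) A = insert (Suc n) B"
    then have "Suc n \<notin> A" "Suc n \<notin> B" by auto
    then show "A = B" using *(3) by (metis Diff_insert_absorb)
  qed
  have "Z (Suc n) y = (\<Sum>A\<in>Pow {1..n}. ?q A * ?W A) + (\<Sum>A\<in>insert (Suc n) ` Pow {1..n}. ?q A * ?W A)"
    unfolding Z_def I Pow_insert by (rule sum.union_disjoint) auto
  also have "(\<Sum>A\<in>insert (Suc n) ` Pow {1..n}. ?q A * ?W A)
      = (\<Sum>A\<in>Pow {1..n}. ?q (insert (Suc n) A) * ?W (insert (Suc n) A))"
    by (simp only: sum.reindex[OF inj] comp_def)
  also have "\<dots> = (\<Sum>A\<in>Pow {1..n}. ?q (insert (Suc n) A) * ?W A * \<zeta> (Suc n) y)"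
  proof (intro sum.cong refl)
    fix A assume A: "A \<in> Pow {1..n}"
    then have "finite A" "Suc n \<notin> A" by (auto intro: finite_subset)
    then show "?q (insert (Suc n) A) * ?W (insert (Suc n) A) = ?q (insert (Suc n) A) * ?W A * \<zeta> (Suc n) y"
      by simp
  qed
  finally have 1: "Z (Suc n) y = (\<Sum>A\<in>Pow {1..n}. ?q A * ?W A) + pinned_Z n y * \<zeta> (Suc n) y"
    unfolding pinned_Z_def sum_distrib_right .
  have "Z n y = (\<Sum>A\<in>Pow {1..n}. ?q A * ?W A + ?q (insert (Suc n) A) * ?W A)"
    unfolding Z_def by (intro sum.cong refl) (subst pattern_prob_Suc, auto simp: distrib_right)
  then have "Z n y = (\<Sum>A\<in>Pow {1..n}. ?q A * ?W A) + pinned_Z n y"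
    unfolding pinned_Z_def sum.distrib .
  with 1 show ?thesis by (simp add: right_diff_distrib)
qed

lemma pinned_Z_square_integrable: "integrable P (\<lambda>y. (pinned_Z n y)\<^sup>2)"
proof -
  have sq: "(pinned_Z n y)\<^sup>2 = (\<Sum>A\<in>Pow {1..n}. \<Sum>B\<in>Pow {1..n}.
      pattern_prob (Suc n) (insert (Suc n) A) * pattern_prob (Suc n) (insert (Suc n) B) * ((\<Prod>n\<in>A. \<zeta> n y) * (\<Prod>n\<in>B. \<zeta> n y)))" for y
    unfolding pinned_Z_def power2_eq_square sum_product by (intro sum.cong refl) (simp only: mult_ac)
  show ?thesis unfolding sq
    by (intro Bochner_Integration.integrable_sum integrable_mult_right env.prod_weights_pair pow_props)
qed

lemma prod_weights_history: "A \<in> Pow {1..n} \<Longrightarrow> (\<lambda>y. \<Prod>i\<in>A. \<zeta> i y) \<in> borel_measurable (env.history n)"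
  by (intro borel_measurable_prod env.measurable_weight_history) auto

lemma square_integrable_martingale_Z: "square_integrable_martingale P env.history Z"
proof
  fix n and f :: "'b \<Rightarrow> real" assume f: "f \<in> borel_measurable (env.history n)"
  show fP: "f \<in> borel_measurable P"
    by (rule env.measurable_from_history[OF refl _ f]) (auto intro: env.measurable_weight)
  show "f \<in> borel_measurable (env.history (Suc n))"
    by (rule env.measurable_from_history[OF env.space_history _ f]) (auto intro!: env.measurable_weight_history)
  assume f2: "integrable P (\<lambda>y. (f y)\<^sup>2)"
  have Y: "pinned_Z n \<in> borel_measurable (env.history n)"
    unfolding pinned_Z_def[abs_def] by (intro borel_measurable_sum borel_measurable_times borel_measurable_const prod_weights_history)
  have YP: "pinned_Z n \<in> borel_measurable P"
    by (rule env.measurable_from_history[OF refl _ Y]) (auto intro: env.measurable_weight)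
  have fY: "(\<lambda>y. f y * pinned_Z n y) \<in> borel_measurable (env.history n)" using f Y by measurable
  have int: "integrable P (\<lambda>y. \<zeta> (Suc n) y - 1)" using env.weights_int[of "Suc n"] by simp
  have "(\<integral>y. f y * (Z (Suc n) y - Z n y) \<partial>P) = (\<integral>y. (f y * pinned_Z n y) * (\<zeta> (Suc n) y - 1) \<partial>P)"
    by (simp only: Z_Suc mult.assoc)
  also have "\<dots> = (\<integral>y. f y * pinned_Z n y \<partial>P) * (\<integral>y. \<zeta> (Suc n) y - 1 \<partial>P)"
    by (rule env.indep_var_lebesgue_integral[OF env.history_indep_next[OF fY]
        integrable_square_mult[OF fP YP f2 pinned_Z_square_integrable] int])
  also have "(\<integral>y. \<zeta> (Suc n) y - 1 \<partial>P) = 0"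
    using env.weights_int[of "Suc n"] env.weights_mean[of "Suc n"] by (simp add: env.prob_space)
  finally show "(\<integral>y. f y * (Z (Suc n) y - Z n y) \<partial>P) = 0" by simp
next
  fix n
  show "Z n \<in> borel_measurable (env.history n)"
    unfolding Z_def[abs_def] by (intro borel_measurable_sum borel_measurable_times borel_measurable_const prod_weights_history)
  show "integrable P (\<lambda>y. (Z n y)\<^sup>2)" by (rule Z_second_moment)
qed

section \<open>The zero-one law and positivity of the limit\<close>

text \<open>
  The first \<open>k\<close> weights are replaced by \<open>1\<close>.
\<close>

definition late_Z :: "nat \<Rightarrow> nat \<Rightarrow> 'b \<Rightarrow> real" where
  "late_Z k N y = (\<Sum>A\<in>Pow {1..N}. pattern_prob N A * (\<Prod>n\<in>A \<inter> {k<..}. \<zeta> n y))"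

lemma late_Z_bounds:
  defines "c \<equiv> \<lambda>k y. \<Prod>n\<in>{1..k}. min 1 (\<zeta> n y)" and "C \<equiv> \<lambda>k y. \<Prod>n\<in>{1..k}. max 1 (\<zeta> n y)"
  shows "0 < c k y" "0 < C k y" "c k y * late_Z k N y \<le> Z N y" "Z N y \<le> C k y * late_Z k N y"
proof -
  show "0 < c k y" "0 < C k y"
    unfolding c_def C_def by (auto intro!: prod_pos simp: env.weights_pos less_max_iff_disj)
  have "c k y * (\<Prod>n\<in>A \<inter> {k<..}. \<zeta> n y) \<le> (\<Prod>n\<in>A. \<zeta> n y) \<and>
      (\<Prod>n\<in>A. \<zeta> n y) \<le> C k y * (\<Prod>n\<in>A \<inter> {k<..}. \<zeta> n y)" if A: "A \<in> Pow {1..N}" for A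
  proof -
    have fin: "finite A" using pow_props[OF A] by simp
    have A_split: "A = (A \<inter> {1..k}) \<union> (A \<inter> {k<..})" using A by auto
    have split: "(\<Prod>n\<in>A. \<zeta> n y) = (\<Prod>n\<in>A \<inter> {1..k}. \<zeta> n y) * (\<Prod>n\<in>A \<inter> {k<..}. \<zeta> n y)"
      by (subst A_split, rule prod.union_disjoint) (use fin in auto)
    have nn: "0 \<le> (\<Prod>n\<in>A \<inter> {k<..}. \<zeta> n y)" by (intro prod_nonneg) (auto intro: less_imp_le env.weights_pos)
    have "c k y = (\<Prod>n\<in>A \<inter> {1..k}. min 1 (\<zeta> n y)) * (\<Prod>n\<in>{1..k} - A. min 1 (\<zeta> n y))"
      unfolding c_def by (subst prod.union_disjoint[symmetric]) (auto intro!: prod.cong)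
    also have "\<dots> \<le> (\<Prod>n\<in>A \<inter> {1..k}. \<zeta> n y) * 1"
      by (intro mult_mono prod_mono prod_le_1 prod_nonneg) (auto intro: less_imp_le env.weights_pos)
    finally have lo: "c k y \<le> (\<Prod>n\<in>A \<inter> {1..k}. \<zeta> n y)" by simp
    have "(\<Prod>n\<in>A \<inter> {1..k}. \<zeta> n y) \<le> (\<Prod>n\<in>A \<inter> {1..k}. max 1 (\<zeta> n y))"
      by (intro prod_mono) (auto intro: less_imp_le env.weights_pos)
    also have "\<dots> \<le> C k y"
      unfolding C_def by (rule prod_mono2) auto
    finally have hi: "(\<Prod>n\<in>A \<inter> {1..k}. \<zeta> n y) \<le> C k y" .
    show ?thesis unfolding split using lo hi nn by (auto intro: mult_right_mono)
  qed
  note b = this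
  have "c k y * late_Z k N y = (\<Sum>A\<in>Pow {1..N}. pattern_prob N A * (c k y * (\<Prod>n\<in>A \<inter> {k<..}. \<zeta> n y)))"
    unfolding late_Z_def sum_distrib_left by (intro sum.cong refl) (simp only: mult_ac)
  also have "\<dots> \<le> Z N y"
    unfolding Z_def by (intro sum_mono mult_left_mono pattern_prob_nonneg) (use b in blast)
  finally show "c k y * late_Z k N y \<le> Z N y" .
  have "Z N y \<le> (\<Sum>A\<in>Pow {1..N}. pattern_prob N A * (C k y * (\<Prod>n\<in>A \<inter> {k<..}. \<zeta> n y)))"
    unfolding Z_def by (intro sum_mono mult_left_mono pattern_prob_nonneg) (use b in blast)
  also have "\<dots> = C k y * late_Z k N y"
    unfolding late_Z_def sum_distrib_left by (intro sum.cong refl) (simp only: mult_ac)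
  finally show "Z N y \<le> C k y * late_Z k N y" .
qed

lemma late_Z_nonneg: "0 \<le> late_Z k N y"
  unfolding late_Z_def by (intro sum_nonneg mult_nonneg_nonneg prod_nonneg) (auto intro: less_imp_le env.weights_pos)

lemma vanishing_iff_late: "(\<lambda>N. Z N y) \<longlonglongrightarrow> 0 \<longleftrightarrow> (\<lambda>N. late_Z k N y) \<longlonglongrightarrow> 0"
proof -
  define c where "c = (\<Prod>n\<in>{1..k}. min 1 (\<zeta> n y))"
  define C where "C = (\<Prod>n\<in>{1..k}. max 1 (\<zeta> n y))"
  note b = late_Z_bounds[where k=k and y=y, folded c_def C_def]
  show ?thesis
  proof
    assume "(\<lambda>N. Z N y) \<longlonglongrightarrow> 0"
    then have "(\<lambda>N. Z N y / c) \<longlonglongrightarrow> 0" by (rule tendsto_divide_zero)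
    then show "(\<lambda>N. late_Z k N y) \<longlonglongrightarrow> 0"
      by (rule tendsto_sandwich[OF _ _ tendsto_const, rotated 2])
        (use b late_Z_nonneg in \<open>auto simp: field_simps\<close>)
  next
    assume "(\<lambda>N. late_Z k N y) \<longlonglongrightarrow> 0"
    then have "(\<lambda>N. C * late_Z k N y) \<longlonglongrightarrow> 0" by (rule tendsto_mult_right_zero)
    then show "(\<lambda>N. Z N y) \<longlonglongrightarrow> 0"
      by (rule tendsto_sandwich[OF _ _ tendsto_const, rotated 2])
        (use b Z_nonneg in auto)
  qed
qed

text \<open>
  For each \<open>k\<close>, \<open>Z N\<close> tends to \<open>0\<close> if and only if \<open>late_Z k N\<close> does, and the latter depends on the weights
  after \<open>k\<close> only. Hence this is a tail event.
\<close>

lemma vanishing_zero_one: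
  "env.prob {y \<in> space P. (\<lambda>N. Z N y) \<longlonglongrightarrow> 0} \<in> {0, 1}"
proof -
  let ?B = "\<lambda>n. {\<zeta> n -` A \<inter> space P | A. A \<in> sets borel}"
  \<comment> \<open>The weights are indexed from \<open>1\<close>, the \<open>\<sigma>\<close>-algebras of the zero-one law from \<open>0\<close>.\<close>
  define A where "A i = sigma_sets (space P) (?B (Suc i))" for i
  have sigma: "sigma_algebra (space P) (A i)" for i
    unfolding A_def by (rule sigma_algebra_sigma_sets) auto
  have "env.indep_sets (\<lambda>n. sigma_sets (space P) (?B n)) {1..}"
    using env.weights_indep unfolding env.indep_vars_def by simp
  then have indep: "env.indep_sets A UNIV"
    unfolding env.indep_sets_def
  proof (elim conjE, intro conjI ballI allI impI)
    fix i assume *: "\<forall>i\<in>{1..}. sigma_sets (space P) (?B i) \<subseteq> env.events"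
    show "A i \<subseteq> env.events" using * by (simp add: A_def)
  next
    fix J :: "nat set" and D
    assume *: "\<forall>J\<subseteq>{1..}. J \<noteq> {} \<longrightarrow> finite J \<longrightarrow>
        (\<forall>D\<in>\<Pi> j\<in>J. sigma_sets (space P) (?B j). env.prob (\<Inter> (D ` J)) = (\<Prod>j\<in>J. env.prob (D j)))"
    assume J: "J \<noteq> {}" "finite J" and D: "D \<in> Pi J A"
    define D' where "D' n = D (n - 1)" for n
    have "D' \<in> (\<Pi> j\<in>Suc ` J. sigma_sets (space P) (?B j))" using D by (auto simp: A_def D'_def)
    then have "env.prob (\<Inter> (D' ` Suc ` J)) = (\<Prod>j\<in>Suc ` J. env.prob (D' j))"
      using *[rule_format, of "Suc ` J" D'] J by auto
    then show "env.prob (\<Inter> (D ` J)) = (\<Prod>j\<in>J. env.prob (D j))"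
      by (simp add: image_image D'_def prod.reindex)
  qed
  have "{y \<in> space P. (\<lambda>N. Z N y) \<longlonglongrightarrow> 0} \<in> env.tail_events A"
    unfolding env.tail_events_def
  proof (rule INT_I)
    fix k
    define S where "S = sigma (space P) (\<Union> (A ` {k..}))"
    have sub: "\<Union> (A ` {k..}) \<subseteq> Pow (space P)"
    proof -
      have "A i \<subseteq> Pow (space P)" for i
        using sigma_sets_into_sp[of "?B (Suc i)" "space P"] unfolding A_def by blast
      then show ?thesis by blast
    qed
    have spS: "space S = space P" unfolding S_def by (rule space_measure_of[OF sub])
    have setsS: "sets S = sigma_sets (space P) (\<Union> (A ` {k..}))" unfolding S_def by (rule sets_measure_of[OF sub])
    have meas: "\<zeta> n \<in> borel_measurable S" if "k < n" for n
    proof (rule measurableI)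
      fix B :: "real set" assume "B \<in> sets borel"
      then have "\<zeta> n -` B \<inter> space P \<in> A (n - 1)"
        using that unfolding A_def by (intro sigma_sets.Basic) auto
      then show "\<zeta> n -` B \<inter> space S \<in> sets S"
        unfolding setsS spS using that by (intro sigma_sets.Basic) auto
    qed simp
    have [measurable]: "late_Z k N \<in> borel_measurable S" for N
      unfolding late_Z_def[abs_def]
      by (intro borel_measurable_sum borel_measurable_times borel_measurable_const borel_measurable_prod meas) auto
    have "{y \<in> space S. (\<lambda>N. late_Z k N y) \<longlonglongrightarrow> 0} \<in> sets S" by measurable
    then show "{y \<in> space P. (\<lambda>N. Z N y) \<longlonglongrightarrow> 0} \<in> sigma_sets (space P) (\<Union> (A ` {k..}))"
      unfolding setsS spS vanishing_iff_late[of _ k] .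
  qed
  from env.kolmogorov_0_1_law[OF sigma indep this] show ?thesis by auto
qed

text \<open>
  By the zero-one law it remains to exclude that \<open>Z N\<close> vanishes in the limit almost surely. In that
  case, the means of \<open>Z N\<close> truncated at \<open>2 * C\<close> would tend to \<open>0\<close> by dominated convergence. The part cut
  off is at most \<open>(Z N)\<^sup>2 / (2 * C)\<close>, whose mean is at most \<open>1/2\<close>, so that the mean \<open>1\<close> of \<open>Z N\<close> leaves
  at least \<open>1/2\<close> for the truncated mean.
\<close>

lemma AE_lim_Z_pos:
  assumes r: "0 \<le> r" "r * intersection_return_prob M \<tau> < 1"
  shows "AE y in P. 0 < lim (\<lambda>N. Z N y)"
proof -
  interpret mart: square_integrable_martingale P env.history Z by (rule square_integrable_martingale_Z)
  define C where "C = 1 / (1 - r * intersection_return_prob M \<tau>)"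
  have C: "0 < C" using r by (simp add: C_def)
  have bound: "(\<integral>y. (Z N y)\<^sup>2 \<partial>P) \<le> C" for N
    unfolding Z_second_moment C_def by (rule overlap_moment_le[OF r])
  have conv: "AE y in P. convergent (\<lambda>N. Z N y)" by (rule mart.AE_convergent[OF bound])
  let ?V = "{y \<in> space P. (\<lambda>N. Z N y) \<longlonglongrightarrow> 0}"
  note [measurable] = mart.measurable_Z
  have V: "?V \<in> env.events" by measurable
  have "env.prob ?V \<noteq> 1"
  proof
    assume "env.prob ?V = 1"
    then have zero: "AE y in P. (\<lambda>N. Z N y) \<longlonglongrightarrow> 0"
      using env.prob_Collect_eq_1[of "\<lambda>y. (\<lambda>N. Z N y) \<longlonglongrightarrow> 0"] V by simp
    have "(\<lambda>N. \<integral>y. min (Z N y) (2 * C) \<partial>P) \<longlonglongrightarrow> (\<integral>y. 0 \<partial>P)"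
    proof (rule integral_dominated_convergence[where w="\<lambda>_. 2 * C"])
      show "AE y in P. (\<lambda>N. min (Z N y) (2 * C)) \<longlonglongrightarrow> 0"
        using zero
      proof eventually_elim
        case (elim y)
        then show ?case using tendsto_min[OF elim tendsto_const[of "2 * C"]] C by simp
      qed
      show "AE y in P. norm (min (Z N y) (2 * C)) \<le> 2 * C" for N
        using Z_nonneg C by (auto simp: min_def)
    qed auto
    then have trunc: "(\<lambda>N. \<integral>y. min (Z N y) (2 * C) \<partial>P) \<longlonglongrightarrow> 0" by simp
    have "1 / 2 \<le> (\<integral>y. min (Z N y) (2 * C) \<partial>P)" for N
    proof -
      have int_min: "integrable P (\<lambda>y. min (Z N y) (2 * C))"
        by (rule Bochner_Integration.integrable_bound[OF Z_mean(1)[of N]])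
          (use Z_nonneg C in \<open>auto simp: min_def\<close>)
      have int_sq: "integrable P (\<lambda>y. (Z N y)\<^sup>2 / (2 * C))" using Z_second_moment(1) by simp
      have "1 = (\<integral>y. Z N y \<partial>P)" by (simp add: Z_mean)
      also have "\<dots> \<le> (\<integral>y. min (Z N y) (2 * C) + (Z N y)\<^sup>2 / (2 * C) \<partial>P)"
      proof (rule integral_mono[OF Z_mean(1)])
        show "integrable P (\<lambda>y. min (Z N y) (2 * C) + (Z N y)\<^sup>2 / (2 * C))" using int_min int_sq by simp
        fix y
        show "Z N y \<le> min (Z N y) (2 * C) + (Z N y)\<^sup>2 / (2 * C)"
        proof (cases "Z N y \<le> 2 * C")
          case False
          then have "2 * C * Z N y \<le> (Z N y)\<^sup>2"
            unfolding power2_eq_square using Z_nonneg by (intro mult_right_mono) auto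
          then have "Z N y \<le> (Z N y)\<^sup>2 / (2 * C)" using C by (simp add: field_simps)
          then show ?thesis using Z_nonneg[of N y] C by (simp add: min_def)
        qed (use C in simp)
      qed
      also have "\<dots> = (\<integral>y. min (Z N y) (2 * C) \<partial>P) + (\<integral>y. (Z N y)\<^sup>2 \<partial>P) / (2 * C)"
        using int_min int_sq by simp
      also have "(\<integral>y. (Z N y)\<^sup>2 \<partial>P) / (2 * C) \<le> C / (2 * C)"
        using bound C by (intro divide_right_mono) auto
      finally show ?thesis using C by simp
    qed
    then have "1 / 2 \<le> (0::real)" using trunc by (intro LIMSEQ_le_const) auto
    then show False by simp
  qed
  then have "env.prob ?V = 0" using vanishing_zero_one by auto
  then have "AE y in P. \<not> (\<lambda>N. Z N y) \<longlonglongrightarrow> 0"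
    using env.prob_Collect_eq_0[of "\<lambda>y. (\<lambda>N. Z N y) \<longlonglongrightarrow> 0"] V by simp
  with conv show ?thesis
  proof eventually_elim
    case (elim y)
    then have lim: "(\<lambda>N. Z N y) \<longlonglongrightarrow> lim (\<lambda>N. Z N y)" by (simp add: convergent_LIMSEQ_iff)
    have "0 \<le> lim (\<lambda>N. Z N y)" by (rule LIMSEQ_le_const[OF lim]) (use Z_nonneg in auto)
    moreover have "lim (\<lambda>N. Z N y) \<noteq> 0" using lim elim(2) by auto
    ultimately show ?case by simp
  qed
qed

end

section \<open>The pinning model below the second-moment threshold\<close>

lemma identically_distributed_integral:
  fixes f :: "real \<Rightarrow> real"
  assumes X: "X \<in> borel_measurable P" and Y: "Y \<in> borel_measurable P"
    and same: "distr P borel X = distr P borel Y" and f: "f \<in> borel_measurable borel"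
  shows "integrable P (\<lambda>y. f (X y)) \<longleftrightarrow> integrable P (\<lambda>y. f (Y y))"
    and "(\<integral>y. f (X y) \<partial>P) = (\<integral>y. f (Y y) \<partial>P)"
  using integrable_distr_eq[OF X f] integrable_distr_eq[OF Y f] integral_distr[OF X f] integral_distr[OF Y f]
  by (simp_all add: same)

theorem proposition1p6:
  fixes M :: "'a measure" and \<tau> :: "nat \<Rightarrow> 'a \<Rightarrow> nat"
    and \<alpha> :: real and L :: "real \<Rightarrow> real"
    and P :: "'b measure" and \<omega> :: "nat \<Rightarrow> 'b \<Rightarrow> real"
  assumes "renewal_process M \<tau> \<alpha> L"
    and "recurrent M \<tau>"
    and "iid_environment P \<omega>"
    and "intersection_transient M \<tau>"
  shows "\<forall>\<beta>\<ge>0. ereal \<beta> < beta2 M \<tau> P \<omega> \<longrightarrow>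
           (AE y in P. limit_partition_function M \<tau> P \<omega> \<beta> y > 0)"
proof (intro allI impI)
  fix \<beta> :: real assume \<beta>: "0 \<le> \<beta>" "ereal \<beta> < beta2 M \<tau> P \<omega>"
  note env = assms(3)[unfolded iid_environment_def]
  note ren = assms(1)[unfolded renewal_process_def]
  interpret R: iid_renewal M \<tau>
    using ren by (intro iid_renewal.intro iid_renewal_axioms.intro) simp_all
  interpret E: prob_space P using env by simp
  have \<omega>_meas: "\<omega> n \<in> borel_measurable P" if "1 \<le> n" for n
    using env that unfolding E.indep_vars_def by auto
  interpret X: exponential_moments P "\<omega> 1"
    by unfold_locales (use env \<omega>_meas in auto)
  have log_mgf: "log_mgf P \<omega> t = ln (X.mgf t)" for t
    by (simp only: log_mgf_def X.mgf_def)
  have nondeg: "\<not> (AE y in P. \<omega> 1 y = x)" for x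
  proof
    assume const: "AE y in P. \<omega> 1 y = x"
    have "(\<integral>y. \<omega> 1 y \<partial>P) = (\<integral>y. x \<partial>P)"
      by (rule integral_cong_AE) (use const in \<open>auto simp: \<omega>_meas\<close>)
    then have "x = 0" using env by (simp add: E.prob_space)
    have "(\<integral>y. (\<omega> 1 y - E.expectation (\<omega> 1))\<^sup>2 \<partial>P) = (\<integral>y. 0 \<partial>P)"
      by (rule integral_cong_AE) (use const \<open>x = 0\<close> env in \<open>auto simp: \<omega>_meas\<close>)
    then show False using env by simp
  qed
  define p where "p = intersection_return_prob M \<tau>"
  define r where "r t = X.mgf (2 * t) / (X.mgf t)\<^sup>2" for t
  have r_pos: "0 < r t" if "0 \<le> t" for t
    unfolding r_def using that by (intro divide_pos_pos zero_less_power X.mgf_pos) auto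
  have p: "0 \<le> p" by (simp add: p_def intersection_return_prob_def)
  have rp: "r \<beta> * p < 1"
  \<comment> \<open>The logarithm of \<open>p\<close> carries information only if \<open>p\<close> is positive; otherwise the claim is immediate.\<close>
  proof (cases "p = 0")
    case False
    with p have p_pos: "0 < p" by simp
    \<comment> \<open>The threshold yields only the weak inequality, but also at a larger parameter \<open>b\<close>; strict monotonicity of \<open>r\<close> does the rest.\<close>
    obtain b where b: "\<beta> < b" "ereal b < beta2 M \<tau> P \<omega>"
      using ereal_dense2[OF \<beta>(2)] by auto
    have b0: "0 \<le> b" using b \<beta> by simp
    have "\<not> log_mgf P \<omega> (2 * b) - 2 * log_mgf P \<omega> b > - ln p"
    proof
      assume "log_mgf P \<omega> (2 * b) - 2 * log_mgf P \<omega> b > - ln p"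
      then have "beta2 M \<tau> P \<omega> \<le> ereal b"
        unfolding beta2_def p_def using b0 by (intro Inf_lower imageI) auto
      then show False using b(2) by simp
    qed
    moreover have "ln (r b) = log_mgf P \<omega> (2 * b) - 2 * log_mgf P \<omega> b"
      unfolding r_def log_mgf using X.mgf_pos[of b] X.mgf_pos[of "2 * b"] b0
      by (simp add: ln_div ln_realpow)
    ultimately have "ln (r b * p) \<le> 0"
      using p_pos r_pos[OF b0] by (simp add: ln_mult)
    then have "r b * p \<le> 1" using p_pos r_pos[OF b0] by simp
    moreover have "r \<beta> < r b"
      unfolding r_def by (rule X.mgf_ratio_strict_mono[OF nondeg \<beta>(1) b(1)])
    ultimately show ?thesis using p_pos by (meson less_le_trans mult_strict_right_mono)
  qed simp
  define \<zeta> where "\<zeta> n y = exp (\<beta> * \<omega> n y - log_mgf P \<omega> \<beta>)" for n y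
  have m_pos: "0 < X.mgf \<beta>" by (rule X.mgf_pos[OF \<beta>(1)])
  have \<zeta>: "\<zeta> n y = exp (\<beta> * \<omega> n y) / X.mgf \<beta>" for n y
    using m_pos by (simp add: \<zeta>_def log_mgf exp_diff)
  have \<zeta>2: "(\<zeta> n y)\<^sup>2 = exp (2 * \<beta> * \<omega> n y) / (X.mgf \<beta>)\<^sup>2" for n y
    unfolding \<zeta> by (simp add: power_divide exp_double[symmetric] mult.assoc)
  have exp_moment: "integrable P (\<lambda>y. exp (t * \<omega> n y))" "(\<integral>y. exp (t * \<omega> n y) \<partial>P) = X.mgf t"
    if "1 \<le> n" "0 \<le> t" for n t
  proof -
    have same: "distr P borel (\<omega> n) = distr P borel (\<omega> 1)" using env that(1) by blast
    note id = identically_distributed_integral[OF \<omega>_meas[OF that(1)] \<omega>_meas[OF order_refl] same,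
        of "\<lambda>x. exp (t * x)"]
    show "integrable P (\<lambda>y. exp (t * \<omega> n y))" using id(1) X.exp_integrable[OF that(2)] by simp
    show "(\<integral>y. exp (t * \<omega> n y) \<partial>P) = X.mgf t" using id(2) by (simp only: X.mgf_def) simp
  qed
  interpret D: disordered_renewal M \<tau> P \<zeta> "r \<beta>"
  proof (intro disordered_renewal.intro R.iid_renewal_axioms random_weights.intro
      random_weights_axioms.intro E.prob_space_axioms)
    have "E.indep_vars (\<lambda>_. borel) \<omega> {1..}" using env by simp
    then show "E.indep_vars (\<lambda>_. borel) \<zeta> {1..}"
      unfolding \<zeta>_def[abs_def] by (rule E.indep_vars_compose2) simp
    show "0 < \<zeta> n y" for n y by (simp add: \<zeta>_def)
    fix n :: nat assume n: "1 \<le> n"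
    show "integrable P (\<zeta> n)" unfolding \<zeta>[abs_def] using exp_moment[OF n \<beta>(1)] by simp
    show "(\<integral>y. \<zeta> n y \<partial>P) = 1" unfolding \<zeta> using exp_moment[OF n \<beta>(1)] m_pos by simp
    show "integrable P (\<lambda>y. (\<zeta> n y)\<^sup>2)" unfolding \<zeta>2 using exp_moment[OF n, of "2 * \<beta>"] \<beta>(1) by simp
    show "(\<integral>y. (\<zeta> n y)\<^sup>2 \<partial>P) = r \<beta>" unfolding \<zeta>2 using exp_moment[OF n, of "2 * \<beta>"] \<beta>(1) by (simp add: r_def)
  qed
  have "partition_function M \<tau> \<beta> (- log_mgf P \<omega> \<beta>) (\<lambda>n. \<omega> n y) N = D.Z N y" for y N
  proof -
    let ?F = "\<lambda>A. exp (\<Sum>n=1..N. (\<beta> * \<omega> n y + - log_mgf P \<omega> \<beta>) * indicator A n)"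
    have F: "?F A = (\<Prod>n\<in>A. \<zeta> n y)" if "A \<in> Pow {1..N}" for A
    proof -
      have "(\<Sum>n=1..N. (\<beta> * \<omega> n y + - log_mgf P \<omega> \<beta>) * indicator A n)
          = (\<Sum>n\<in>A. \<beta> * \<omega> n y - log_mgf P \<omega> \<beta>)"
        using that by (intro sum.mono_neutral_cong_right) auto
      then show ?thesis
        using that by (simp add: \<zeta>_def exp_sum finite_subset[of A "{1..N}"])
    qed
    have "partition_function M \<tau> \<beta> (- log_mgf P \<omega> \<beta>) (\<lambda>n. \<omega> n y) N
        = (\<integral>x. ?F (renewal_set \<tau> x \<inter> {1..N}) \<partial>M)"
      unfolding partition_function_def
      by (intro Bochner_Integration.integral_cong refl arg_cong[where f=exp] sum.cong) (auto simp: indicator_def)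
    also have "\<dots> = (\<Sum>A\<in>Pow {1..N}. R.pattern_prob N A * ?F A)" by (rule R.integral_pattern)
    also have "\<dots> = D.Z N y" unfolding D.Z_def by (intro sum.cong refl) (simp only: F)
    finally show ?thesis .
  qed
  then have "limit_partition_function M \<tau> P \<omega> \<beta> y = lim (\<lambda>N. D.Z N y)" for y
    by (simp add: limit_partition_function_def)
  moreover have "AE y in P. 0 < lim (\<lambda>N. D.Z N y)"
    using r_pos[OF \<beta>(1)] rp by (intro D.AE_lim_Z_pos) (auto simp: p_def)
  ultimately show "AE y in P. limit_partition_function M \<tau> P \<omega> \<beta> y > 0" by simp
qed

end
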